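(* Let $X_n$ be a finite Dynkin diagram (one of $A_n,B_n,C_n,D_n,E_6,E_7,E_8,F_4,G_2$) with set of positive roots $\Phi_+$. Let $U_{X_n}$ and $H_{X_n}$ be the filtered commutative rings defined in the context, and let $\rho: U_{X_n}\to H_{X_n}$ be the unique morphism of filtered rings with $\rho(u_\alpha)=h_\alpha$ for all $\alpha\in\Phi_+$. Then $\rho$ is an isomorphism of filtered rings between $U_{X_n}$ and $H_{X_n}$, i.e. $\rho$ is a ring isomorphism and $\rho(\mathcal{F}_k U_{X_n})=\mathcal{F}_k H_{X_n}$ for all $k\ge 0$.
   Context: Rings are commutative with unit. $\Phi_+$ is the set of positive roots of the (irreducible, reduced, crystallographic) root system of type $X_n$, with the partial order $\alpha\le\beta$ iff $\beta-\alpha$ has non-negative coefficients in the basis of simple roots. Roots are regarded as linear forms on a real vector space $V$ of dimension $n$ (the simple roots form a basis of $V^*$). The Shi arrangement is the collection of hyperplanes $\alpha(x)=0$ and $\alpha(x)=1$, $\alpha\in\Phi_+$. The dominant Weyl chamber is $\{x\in V:\alpha(x)>0\ \forall\alpha\in\Phi_+\}$. Ring $H_{X_n}$: the ring (pointwise operations) of locally constant integer-valued functions on the intersection of the dominant Weyl chamber with the complement of the union of the Shi hyperplanes. For $\alpha\in\Phi_+$, $h_\alpha\in H_{X_n}$ is the function with $h_\alpha(x)=1$ if $\alpha(x)>1$ and $h_\alpha(x)=0$ if $\alpha(x)<1$. Filtration: $\mathcal{F}_0H_{X_n}=\mathbb{Z}1$, $\mathcal{F}_1H_{X_n}$ is the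 $\mathbb{Z}$-linear span of $1$ and all $h_\alpha$, and $\mathcal{F}_kH_{X_n}=(\mathcal{F}_1H_{X_n})^k$ (the $\mathbb{Z}$-span of products of $k$ elements of $\mathcal{F}_1H_{X_n}$) for $k>1$. Ring $U_{X_n}$: the commutative ring (over $\mathbb{Z}$) generated by variables $u_\alpha$, $\alpha\in\Phi_+$, modulo the relations $u_\alpha u_\beta=u_{\min(\alpha,\beta)}$ for all $\alpha,\beta\in\Phi_+$ that are comparable for $\le$ (including $\alpha=\beta$, i.e. $u_\alpha^2=u_\alpha$). Filtration: $\mathcal{F}_0U_{X_n}=\mathbb{Z}1$, $\mathcal{F}_1U_{X_n}$ is the $\mathbb{Z}$-linear span of $1$ and all $u_\alpha$, and $\mathcal{F}_kU_{X_n}=(\mathcal{F}_1U_{X_n})^k$ for $k>1$. A morphism of filtered rings is a ring morphism mapping $\mathcal{F}_k$ into $\mathcal{F}_k$ for all $k$. *)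

theory Defs
  imports "HOL-Analysis.Analysis" "HOL-Library.Poly_Mapping" "HOL-Algebra.QuotRing"
    "HOL-Algebra.Generated_Groups"
begin

section \<open>Finite Dynkin diagrams\<close>

datatype dynkin = TypeA nat | TypeB nat | TypeC nat | TypeD nat
  | TypeE6 | TypeE7 | TypeE8 | TypeF4 | TypeG2

text \<open>
  The overlap B2 = C2 is harmless; A3 = D3 is avoided by requiring rank at least 4 in type D.
\<close>
fun finite_dynkin :: "dynkin \<Rightarrow> bool" where
  "finite_dynkin (TypeA n) = (n \<ge> 1)"
| "finite_dynkin (TypeB n) = (n \<ge> 2)"
| "finite_dynkin (TypeC n) = (n \<ge> 2)"
| "finite_dynkin (TypeD n) = (n \<ge> 4)"
| "finite_dynkin _ = True"

fun rank :: "dynkin \<Rightarrow> nat" where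
  "rank (TypeA n) = n"
| "rank (TypeB n) = n"
| "rank (TypeC n) = n"
| "rank (TypeD n) = n"
| "rank TypeE6 = 6"
| "rank TypeE7 = 7"
| "rank TypeE8 = 8"
| "rank TypeF4 = 4"
| "rank TypeG2 = 2"

text \<open>The nodes are numbered as in Bourbaki, shifted so as to start at \<open>0\<close>.\<close>

fun edges :: "dynkin \<Rightarrow> (nat \<times> nat) set" where
  "edges (TypeA n) = {(i, i + 1) | i. i + 1 < n}"
| "edges (TypeB n) = {(i, i + 1) | i. i + 1 < n}"
| "edges (TypeC n) = {(i, i + 1) | i. i + 1 < n}"
| "edges (TypeD n) = {(i, i + 1) | i. i + 2 < n} \<union> {(n - 3, n - 1)}"
| "edges TypeE6 = {(0, 2), (2, 3), (3, 4), (4, 5), (1, 3)}"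
| "edges TypeE7 = {(0, 2), (2, 3), (3, 4), (4, 5), (5, 6), (1, 3)}"
| "edges TypeE8 = {(0, 2), (2, 3), (3, 4), (4, 5), (5, 6), (6, 7), (1, 3)}"
| "edges TypeF4 = {(0, 1), (1, 2), (2, 3)}"
| "edges TypeG2 = {(0, 1)}"

text \<open>
  \<open>multiple_edge X i j\<close> is the multiplicity of the edge if it points from the long root \<open>i\<close>
  to the short root \<open>j\<close>, and \<open>1\<close> otherwise.
\<close>
fun multiple_edge :: "dynkin \<Rightarrow> nat \<Rightarrow> nat \<Rightarrow> int" where
  "multiple_edge (TypeB n) i j = (if i = n - 2 \<and> j = n - 1 then 2 else 1)"
| "multiple_edge (TypeC n) i j = (if i = n - 1 \<and> j = n - 2 then 2 else 1)"
| "multiple_edge TypeF4 i j = (if i = 1 \<and> j = 2 then 2 else 1)"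
| "multiple_edge TypeG2 i j = (if i = 1 \<and> j = 0 then 3 else 1)"
| "multiple_edge _ i j = 1"

definition cartan_matrix :: "dynkin \<Rightarrow> nat \<Rightarrow> nat \<Rightarrow> int" where
  "cartan_matrix X i j =
     (if i = j then 2
      else if (i, j) \<in> edges X \<or> (j, i) \<in> edges X then - multiple_edge X i j
      else 0)"

section \<open>Root systems\<close>

definition cartan_int :: "'a::euclidean_space \<Rightarrow> 'a \<Rightarrow> real" where
  "cartan_int \<beta> \<alpha> = 2 * (\<beta> \<bullet> \<alpha>) / (\<alpha> \<bullet> \<alpha>)"

definition root_reflection :: "'a::euclidean_space \<Rightarrow> 'a \<Rightarrow> 'a" where
  "root_reflection \<alpha> \<beta> = \<beta> - cartan_int \<beta> \<alpha> *\<^sub>R \<alpha>"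

text \<open>Reduced crystallographic root systems.\<close>
definition root_system :: "'a::euclidean_space set \<Rightarrow> bool" where
  "root_system \<Phi> \<longleftrightarrow>
     finite \<Phi> \<and> 0 \<notin> \<Phi> \<and> span \<Phi> = UNIV \<and>
     (\<forall>\<alpha>\<in>\<Phi>. \<forall>\<beta>\<in>\<Phi>. root_reflection \<alpha> \<beta> \<in> \<Phi>) \<and>
     (\<forall>\<alpha>\<in>\<Phi>. \<forall>\<beta>\<in>\<Phi>. cartan_int \<beta> \<alpha> \<in> \<int>) \<and>
     (\<forall>\<alpha>\<in>\<Phi>. \<forall>c. c *\<^sub>R \<alpha> \<in> \<Phi> \<longrightarrow> c = 1 \<or> c = - 1)"

definition irreducible_roots :: "'a::euclidean_space set \<Rightarrow> bool" where
  "irreducible_roots \<Phi> \<longleftrightarrow>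
     \<Phi> \<noteq> {} \<and>
     \<not> (\<exists>\<Phi>1 \<Phi>2. \<Phi>1 \<noteq> {} \<and> \<Phi>2 \<noteq> {} \<and> \<Phi>1 \<union> \<Phi>2 = \<Phi> \<and>
          (\<forall>\<alpha>\<in>\<Phi>1. \<forall>\<beta>\<in>\<Phi>2. \<alpha> \<bullet> \<beta> = 0))"

definition simple_roots :: "'a::euclidean_space set \<Rightarrow> 'a set \<Rightarrow> bool" where
  "simple_roots \<Phi> \<Delta> \<longleftrightarrow>
     \<Delta> \<subseteq> \<Phi> \<and> independent \<Delta> \<and>
     (\<forall>\<beta>\<in>\<Phi>. \<exists>c :: 'a \<Rightarrow> int. \<beta> = (\<Sum>\<delta>\<in>\<Delta>. of_int (c \<delta>) *\<^sub>R \<delta>) \<and>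
        ((\<forall>\<delta>\<in>\<Delta>. c \<delta> \<ge> 0) \<or> (\<forall>\<delta>\<in>\<Delta>. c \<delta> \<le> 0)))"

definition has_dynkin_type :: "'a::euclidean_space set \<Rightarrow> dynkin \<Rightarrow> bool" where
  "has_dynkin_type \<Delta> X \<longleftrightarrow>
     (\<exists>s. bij_betw s {..<rank X} \<Delta> \<and>
        (\<forall>i<rank X. \<forall>j<rank X. cartan_int (s i) (s j) = of_int (cartan_matrix X i j)))"

definition root_le :: "'a::euclidean_space set \<Rightarrow> 'a \<Rightarrow> 'a \<Rightarrow> bool" where
  "root_le \<Delta> \<alpha> \<beta> \<longleftrightarrow>
     (\<exists>c :: 'a \<Rightarrow> real. (\<forall>\<delta>\<in>\<Delta>. c \<delta> \<ge> 0) \<and> \<beta> - \<alpha> = (\<Sum>\<delta>\<in>\<Delta>. c \<delta> *\<^sub>R \<delta>))"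

definition positive_roots :: "'a::euclidean_space set \<Rightarrow> 'a set \<Rightarrow> 'a set" where
  "positive_roots \<Phi> \<Delta> = {\<beta> \<in> \<Phi>. root_le \<Delta> 0 \<beta>}"

section \<open>Filtered rings\<close>

text \<open>\<open>generate (add_monoid R) S\<close> is the additive subgroup generated by \<open>S\<close>, i.e.\ its integer span.\<close>
definition int_span :: "('r, 'm) ring_scheme \<Rightarrow> 'r set \<Rightarrow> 'r set" where
  "int_span R S = generate (add_monoid R) S"

definition F1 :: "('r, 'm) ring_scheme \<Rightarrow> 'r set \<Rightarrow> 'r set" where
  "F1 R G = int_span R (insert \<one>\<^bsub>R\<^esub> G)"

definition filtration :: "('r, 'm) ring_scheme \<Rightarrow> 'r set \<Rightarrow> nat \<Rightarrow> 'r set" where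
  "filtration R G k =
     (if k = 0 then int_span R {\<one>\<^bsub>R\<^esub>}
      else if k = 1 then F1 R G
      else int_span R {finprod R f {..<k} | f. f \<in> {..<k} \<rightarrow> F1 R G})"

definition filtered_hom ::
  "('r, 'm) ring_scheme \<Rightarrow> (nat \<Rightarrow> 'r set) \<Rightarrow> ('s, 'n) ring_scheme \<Rightarrow> (nat \<Rightarrow> 's set) \<Rightarrow> ('r \<Rightarrow> 's) set"
  where "filtered_hom R F S G = {\<rho> \<in> ring_hom R S. \<forall>k. \<rho> ` F k \<subseteq> G k}"

definition filtered_iso ::
  "('r, 'm) ring_scheme \<Rightarrow> (nat \<Rightarrow> 'r set) \<Rightarrow> ('s, 'n) ring_scheme \<Rightarrow> (nat \<Rightarrow> 's set) \<Rightarrow> ('r \<Rightarrow> 's) set"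
  where "filtered_iso R F S G = {\<rho> \<in> ring_iso R S. \<forall>k. \<rho> ` F k = G k}"

section \<open>The ring \<open>U\<close>\<close>

text \<open>
  Polynomials over the integers are finitely supported functions from monomials to
  coefficients, a monomial being a finitely supported function from variables to exponents.
\<close>
type_synonym 'v int_mpoly = "('v \<Rightarrow>\<^sub>0 nat) \<Rightarrow>\<^sub>0 int"

definition var :: "'v \<Rightarrow> 'v int_mpoly" where
  "var v = Poly_Mapping.single (Poly_Mapping.single v 1) 1"

definition int_poly_ring :: "'v set \<Rightarrow> 'v int_mpoly ring" where
  "int_poly_ring S =
     \<lparr>carrier = {p. \<forall>m\<in>Poly_Mapping.keys p. Poly_Mapping.keys m \<subseteq> S},
      mult = (*), one = 1, zero = 0, add = (+)\<rparr>"

lemma int_poly_vars_times: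
  assumes "\<forall>m\<in>Poly_Mapping.keys p. Poly_Mapping.keys m \<subseteq> S" "\<forall>m\<in>Poly_Mapping.keys q. Poly_Mapping.keys m \<subseteq> S"
  shows "\<forall>m\<in>Poly_Mapping.keys (p * q :: 'v int_mpoly). Poly_Mapping.keys m \<subseteq> S"
proof
  fix m assume "m \<in> Poly_Mapping.keys (p * q)"
  then obtain a b where "m = a + b" "a \<in> Poly_Mapping.keys p" "b \<in> Poly_Mapping.keys q"
    using keys_mult[of p q] by blast
  then show "Poly_Mapping.keys m \<subseteq> S" using assms Poly_Mapping.keys_add[of a b] by blast
qed

lemma int_poly_ring_cring: "cring (int_poly_ring S)"
proof (rule cringI)
  show "abelian_group (int_poly_ring S)"
  proof (rule abelian_groupI, goal_cases)
    case (1 x y) then show ?case using Poly_Mapping.keys_add[of x y] by (fastforce simp: int_poly_ring_def)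
  next
    case (6 x) then show ?case
      by (intro bexI[of _ "-x"]) (auto simp: int_poly_ring_def)
  qed (auto simp: int_poly_ring_def algebra_simps)
  show "comm_monoid (int_poly_ring S)"
  proof (rule comm_monoidI, goal_cases)
    case (1 x y) then show ?case using int_poly_vars_times[of x S y] by (simp add: int_poly_ring_def)
  qed (auto simp: int_poly_ring_def algebra_simps)
qed (auto simp: int_poly_ring_def algebra_simps)

definition U_ideal :: "'a::euclidean_space set \<Rightarrow> 'a set \<Rightarrow> 'a int_mpoly set" where
  "U_ideal \<Phi> \<Delta> = Idl\<^bsub>int_poly_ring (positive_roots \<Phi> \<Delta>)\<^esub>
     {var \<alpha> * var \<beta> - var \<alpha> | \<alpha> \<beta>.
        \<alpha> \<in> positive_roots \<Phi> \<Delta> \<and> \<beta> \<in> positive_roots \<Phi> \<Delta> \<and> root_le \<Delta> \<alpha> \<beta>}"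

definition U_ring :: "'a::euclidean_space set \<Rightarrow> 'a set \<Rightarrow> 'a int_mpoly set ring" where
  "U_ring \<Phi> \<Delta> = int_poly_ring (positive_roots \<Phi> \<Delta>) Quot U_ideal \<Phi> \<Delta>"

definition u_gen :: "'a::euclidean_space set \<Rightarrow> 'a set \<Rightarrow> 'a \<Rightarrow> 'a int_mpoly set" where
  "u_gen \<Phi> \<Delta> \<alpha> = U_ideal \<Phi> \<Delta> +>\<^bsub>int_poly_ring (positive_roots \<Phi> \<Delta>)\<^esub> var \<alpha>"

definition U_filt :: "'a::euclidean_space set \<Rightarrow> 'a set \<Rightarrow> nat \<Rightarrow> 'a int_mpoly set set" where
  "U_filt \<Phi> \<Delta> = filtration (U_ring \<Phi> \<Delta>) (u_gen \<Phi> \<Delta> ` positive_roots \<Phi> \<Delta>)"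

section \<open>The ring \<open>H\<close>\<close>

text \<open>A root \<open>\<alpha>\<close> is regarded as the linear form \<open>x \<mapsto> \<alpha> \<bullet> x\<close>.\<close>

definition shi_arrangement :: "'a::euclidean_space set \<Rightarrow> 'a set \<Rightarrow> 'a set set" where
  "shi_arrangement \<Phi> \<Delta> =
     {{x. \<alpha> \<bullet> x = 0} | \<alpha>. \<alpha> \<in> positive_roots \<Phi> \<Delta>} \<union>
     {{x. \<alpha> \<bullet> x = 1} | \<alpha>. \<alpha> \<in> positive_roots \<Phi> \<Delta>}"

definition dominant_chamber :: "'a::euclidean_space set \<Rightarrow> 'a set \<Rightarrow> 'a set" where
  "dominant_chamber \<Phi> \<Delta> = {x. \<forall>\<alpha>\<in>positive_roots \<Phi> \<Delta>. \<alpha> \<bullet> x > 0}"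

definition shi_domain :: "'a::euclidean_space set \<Rightarrow> 'a set \<Rightarrow> 'a set" where
  "shi_domain \<Phi> \<Delta> = dominant_chamber \<Phi> \<Delta> \<inter> - \<Union>(shi_arrangement \<Phi> \<Delta>)"

definition locally_constant_on :: "'a::topological_space set \<Rightarrow> ('a \<Rightarrow> 'b) \<Rightarrow> bool" where
  "locally_constant_on S f \<longleftrightarrow>
     (\<forall>x\<in>S. \<exists>T. openin (top_of_set S) T \<and> x \<in> T \<and> f constant_on T)"

text \<open>Functions on \<open>S\<close> are represented by functions that are \<open>undefined\<close> outside \<open>S\<close>.\<close>
definition locally_constant_ring :: "'a::topological_space set \<Rightarrow> ('a \<Rightarrow> int) ring" where
  "locally_constant_ring S =
     \<lparr>carrier = {f \<in> extensional S. locally_constant_on S f},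
      mult = (\<lambda>f g. \<lambda>x\<in>S. f x * g x), one = (\<lambda>x\<in>S. 1),
      zero = (\<lambda>x\<in>S. 0), add = (\<lambda>f g. \<lambda>x\<in>S. f x + g x)\<rparr>"

lemma locally_constant_on_binop:
  assumes "locally_constant_on S f" "locally_constant_on S g"
  shows "locally_constant_on S (\<lambda>x\<in>S. h (f x) (g x))"
  unfolding locally_constant_on_def
proof
  fix x assume "x \<in> S"
  then obtain T U where "openin (top_of_set S) T" "x \<in> T" "f constant_on T"
    "openin (top_of_set S) U" "x \<in> U" "g constant_on U"
    using assms unfolding locally_constant_on_def by meson
  moreover from this have "T \<subseteq> S" by (meson openin_imp_subset)
  ultimately show "\<exists>T. openin (top_of_set S) T \<and> x \<in> T \<and> (\<lambda>x\<in>S. h (f x) (g x)) constant_on T"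
    by (intro exI[of _ "T \<inter> U"]) (auto simp: constant_on_def subset_iff)
qed

lemma locally_constant_on_const: "locally_constant_on S (\<lambda>x\<in>S. c)"
  unfolding locally_constant_on_def constant_on_def by (intro ballI exI[of _ S]) auto

lemma locally_constant_ring_cring: "cring (locally_constant_ring S)"
proof (rule cringI)
  show "abelian_group (locally_constant_ring S)"
  proof (rule abelian_groupI, goal_cases)
    case (6 f) then show ?case
      using locally_constant_on_binop[of S f f "\<lambda>a b. - a"]
      by (auto simp: locally_constant_ring_def fun_eq_iff intro!: bexI[of _ "\<lambda>x\<in>S. - f x"])
  qed (auto simp: locally_constant_ring_def locally_constant_on_const locally_constant_on_binop
        fun_eq_iff extensional_def)
  show "comm_monoid (locally_constant_ring S)"
    by (rule comm_monoidI)
      (auto simp: locally_constant_ring_def locally_constant_on_const locally_constant_on_binop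
        fun_eq_iff extensional_def)
qed (auto simp: locally_constant_ring_def fun_eq_iff algebra_simps)

definition H_ring :: "'a::euclidean_space set \<Rightarrow> 'a set \<Rightarrow> ('a \<Rightarrow> int) ring" where
  "H_ring \<Phi> \<Delta> = locally_constant_ring (shi_domain \<Phi> \<Delta>)"

definition h_fun :: "'a::euclidean_space set \<Rightarrow> 'a set \<Rightarrow> 'a \<Rightarrow> 'a \<Rightarrow> int" where
  "h_fun \<Phi> \<Delta> \<alpha> = (\<lambda>x\<in>shi_domain \<Phi> \<Delta>. if \<alpha> \<bullet> x > 1 then 1 else 0)"

definition H_filt :: "'a::euclidean_space set \<Rightarrow> 'a set \<Rightarrow> nat \<Rightarrow> ('a \<Rightarrow> int) set" where
  "H_filt \<Phi> \<Delta> = filtration (H_ring \<Phi> \<Delta>) (h_fun \<Phi> \<Delta> ` positive_roots \<Phi> \<Delta>)"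

end

theory Submission
  imports Defs "HOL-Analysis.Kronecker_Approximation_Theorem"
begin

text \<open>
  On the dominant chamber \<open>\<alpha> \<le> \<beta>\<close> implies \<open>\<alpha>(x) \<le> \<beta>(x)\<close>, so a region of the Shi arrangement in the
  chamber is the convex set of points \<open>x\<close> for which \<open>{\<alpha>. \<alpha>(x) > 1}\<close> is a given upper set of
  positive roots. Every upper set occurs (Shi): otherwise Gordan's theorem, made integral by
  Dirichlet approximation, yields a relation \<open>\<Sum>\<alpha>\<^sub>i + \<Sum>\<gamma>\<^sub>k = \<Sum>\<beta>\<^sub>j\<close> between positive roots with at least
  as many \<open>\<alpha>\<^sub>i\<close> inside the upper set as \<open>\<beta>\<^sub>j\<close> outside, and such a relation forces \<open>\<alpha>\<^sub>i \<le> \<beta>\<^sub>j\<close> for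
  some \<open>i, j\<close>. Hence \<open>H\<close> is the ring of integer functions on the set of upper sets. In \<open>U\<close> a monomial
  only depends on the upper set generated by its variables, and evaluating these monomials at
  upper sets gives a unitriangular matrix, so \<open>\<rho>\<close> is bijective. The filtrations correspond because
  \<open>\<rho>\<close> matches the generators.
\<close>

section \<open>Relations between positive roots\<close>

lemma root_le_refl: "root_le \<Delta> \<alpha> \<alpha>"
  unfolding root_le_def by (intro exI[of _ "\<lambda>_. 0"]) simp

lemma root_le_trans:
  assumes "root_le \<Delta> \<alpha> \<beta>" "root_le \<Delta> \<beta> \<gamma>"
  shows "root_le \<Delta> \<alpha> \<gamma>"
proof -
  obtain c d where c: "\<forall>\<delta>\<in>\<Delta>. c \<delta> \<ge> 0" "\<beta> - \<alpha> = (\<Sum>\<delta>\<in>\<Delta>. c \<delta> *\<^sub>R \<delta>)"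
    and d: "\<forall>\<delta>\<in>\<Delta>. d \<delta> \<ge> 0" "\<gamma> - \<beta> = (\<Sum>\<delta>\<in>\<Delta>. d \<delta> *\<^sub>R \<delta>)"
    using assms unfolding root_le_def by blast
  have "\<gamma> - \<alpha> = (\<beta> - \<alpha>) + (\<gamma> - \<beta>)" by simp
  also have "\<dots> = (\<Sum>\<delta>\<in>\<Delta>. (c \<delta> + d \<delta>) *\<^sub>R \<delta>)"
    unfolding c d by (simp add: scaleR_add_left sum.distrib)
  finally show ?thesis unfolding root_le_def using c(1) d(1)
    by (intro exI[of _ "\<lambda>\<delta>. c \<delta> + d \<delta>"]) simp
qed

lemma root_le_diff_iff: "root_le \<Delta> 0 (\<beta> - \<alpha>) \<longleftrightarrow> root_le \<Delta> \<alpha> \<beta>"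
  by (simp add: root_le_def)

section \<open>Positive roots: signs, differences and heights\<close>

locale simple_root_system =
  fixes \<Phi> \<Delta> :: "'a::euclidean_space set"
  assumes root_system: "root_system \<Phi>" and simple_roots: "simple_roots \<Phi> \<Delta>"
begin

abbreviation pos :: "'a set" where "pos \<equiv> positive_roots \<Phi> \<Delta>"

lemma
  shows finite_roots: "finite \<Phi>"
    and zero_not_root: "0 \<notin> \<Phi>"
    and span_roots: "span \<Phi> = UNIV"
    and reflection_root: "\<alpha> \<in> \<Phi> \<Longrightarrow> \<beta> \<in> \<Phi> \<Longrightarrow> root_reflection \<alpha> \<beta> \<in> \<Phi>"
    and cartan_int_Ints: "\<alpha> \<in> \<Phi> \<Longrightarrow> \<beta> \<in> \<Phi> \<Longrightarrow> cartan_int \<beta> \<alpha> \<in> \<int>"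
    and reduced: "\<alpha> \<in> \<Phi> \<Longrightarrow> c *\<^sub>R \<alpha> \<in> \<Phi> \<Longrightarrow> c = 1 \<or> c = - 1"
  using root_system by (auto simp: root_system_def)

lemma
  shows simple_subset: "\<Delta> \<subseteq> \<Phi>" and independent_simple: "independent \<Delta>"
  using simple_roots by (auto simp: simple_roots_def)

lemma finite_simple: "finite \<Delta>"
  using finite_roots simple_subset finite_subset by blast

lemma root_expansion:
  assumes "\<beta> \<in> \<Phi>"
  obtains c :: "'a \<Rightarrow> int" where "\<beta> = (\<Sum>\<delta>\<in>\<Delta>. of_int (c \<delta>) *\<^sub>R \<delta>)"
    "(\<forall>\<delta>\<in>\<Delta>. c \<delta> \<ge> 0) \<or> (\<forall>\<delta>\<in>\<Delta>. c \<delta> \<le> 0)"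
  using simple_roots assms unfolding simple_roots_def by blast

lemma pos_root: "\<alpha> \<in> pos \<Longrightarrow> \<alpha> \<in> \<Phi>" and pos_ge_0: "\<alpha> \<in> pos \<Longrightarrow> root_le \<Delta> 0 \<alpha>"
  by (auto simp: positive_roots_def)

lemma finite_pos: "finite pos"
  using finite_roots by (simp add: positive_roots_def)

text \<open>Reflecting a root in itself negates it, so \<open>- \<beta>\<close> is a root too. The
  integer coefficients in the simple roots all have one sign, which decides the alternative.\<close>

lemma pos_or_neg:
  assumes "\<beta> \<in> \<Phi>"
  shows "\<beta> \<in> pos \<or> - \<beta> \<in> pos"
proof -
  have "root_reflection \<beta> \<beta> = - \<beta>"
    using assms zero_not_root
    by (auto simp: root_reflection_def cartan_int_def scaleR_2 dest: inner_eq_zero_iff[THEN iffD1])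
  then have neg: "- \<beta> \<in> \<Phi>" using reflection_root[OF assms assms] by simp
  obtain c :: "'a \<Rightarrow> int" where c: "\<beta> = (\<Sum>\<delta>\<in>\<Delta>. of_int (c \<delta>) *\<^sub>R \<delta>)"
    "(\<forall>\<delta>\<in>\<Delta>. c \<delta> \<ge> 0) \<or> (\<forall>\<delta>\<in>\<Delta>. c \<delta> \<le> 0)"
    using root_expansion assms by blast
  from c(2) show ?thesis
  proof
    assume "\<forall>\<delta>\<in>\<Delta>. c \<delta> \<ge> 0"
    then have "root_le \<Delta> 0 \<beta>" unfolding root_le_def
      by (intro exI[of _ "\<lambda>\<delta>. of_int (c \<delta>)"]) (simp flip: c(1))
    then show ?thesis using assms by (simp add: positive_roots_def)
  next
    assume "\<forall>\<delta>\<in>\<Delta>. c \<delta> \<le> 0"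
    then have "root_le \<Delta> 0 (- \<beta>)" unfolding root_le_def
      by (subst c(1), intro exI[of _ "\<lambda>\<delta>. - of_int (c \<delta>)"]) (simp add: sum_negf)
    then show ?thesis using neg by (simp add: positive_roots_def)
  qed
qed

text \<open>The product of the two Cartan integers is \<open>4 cos\<^sup>2\<close> of the angle, so one of them is \<open>1\<close>.\<close>
lemma root_diff:
  assumes "\<alpha> \<in> \<Phi>" "\<beta> \<in> \<Phi>" "\<alpha> \<noteq> \<beta>" "\<alpha> \<bullet> \<beta> > 0"
  shows "\<beta> - \<alpha> \<in> pos \<or> \<alpha> - \<beta> \<in> pos"
proof -
  have nz: "\<alpha> \<noteq> 0" "\<beta> \<noteq> 0" using assms by auto
  have pp: "\<alpha> \<bullet> \<alpha> > 0" "\<beta> \<bullet> \<beta> > 0" using nz by auto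
  have lt: "(\<alpha> \<bullet> \<beta>)\<^sup>2 < (\<alpha> \<bullet> \<alpha>) * (\<beta> \<bullet> \<beta>)"
  proof (rule ccontr)
    assume "\<not> ?thesis"
    then have eq: "(\<alpha> \<bullet> \<beta>)\<^sup>2 = (\<alpha> \<bullet> \<alpha>) * (\<beta> \<bullet> \<beta>)" using Cauchy_Schwarz_ineq[of \<alpha> \<beta>] by simp
    \<comment> \<open>Equality in Cauchy-Schwarz makes the residual of projecting
      \<open>\<beta>\<close> onto the line of \<open>\<alpha>\<close> vanish. Then
      \<open>\<beta>\<close> is a positive multiple of \<open>\<alpha>\<close>, and reducedness
      forces the two roots to coincide.\<close>
    define t where "t = (\<alpha> \<bullet> \<beta>) / (\<alpha> \<bullet> \<alpha>)"
    have "(\<beta> - t *\<^sub>R \<alpha>) \<bullet> (\<beta> - t *\<^sub>R \<alpha>) = \<beta> \<bullet> \<beta> - (\<alpha> \<bullet> \<beta>)\<^sup>2 / (\<alpha> \<bullet> \<alpha>)"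
      using pp(1) by (simp add: t_def inner_diff_left inner_diff_right inner_commute
        field_simps power2_eq_square)
    also have "\<dots> = 0" using pp(1) eq by simp
    finally have b: "\<beta> = t *\<^sub>R \<alpha>" by simp
    have "t = 1 \<or> t = -1" using reduced assms(1,2) b by blast
    moreover have "t > 0" using assms(4) pp by (simp add: t_def)
    ultimately show False using b assms(3) by auto
  qed
  obtain k l :: int where k: "cartan_int \<beta> \<alpha> = k" and l: "cartan_int \<alpha> \<beta> = l"
    using cartan_int_Ints assms(1,2) by (metis Ints_cases)
  have "real_of_int k > 0" "real_of_int l > 0"
    unfolding k[symmetric] l[symmetric] cartan_int_def
    using assms(4) pp by (auto simp: inner_commute)
  then have kl: "k > 0" "l > 0" by auto
  have "real_of_int k * of_int l = 4 * ((\<alpha> \<bullet> \<beta>)\<^sup>2 / ((\<alpha> \<bullet> \<alpha>) * (\<beta> \<bullet> \<beta>)))"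
    unfolding k[symmetric] l[symmetric] cartan_int_def
    by (simp add: inner_commute power2_eq_square)
  also have "\<dots> < 4" using lt pp by (simp add: divide_less_eq)
  finally have "real_of_int (k * l) < 4" by simp
  then have "k * l < 4" by linarith
  then have "k = 1 \<or> l = 1"
  proof (rule contrapos_pp)
    assume "\<not> (k = 1 \<or> l = 1)"
    then have "2 * 2 \<le> k * l" using kl by (intro mult_mono) auto
    then show "\<not> k * l < 4" by simp
  qed
  \<comment> \<open>If \<open>k\<close> is 1, the reflection of \<open>\<beta>\<close> in
    \<open>\<alpha>\<close> is exactly \<open>\<beta> - \<alpha>\<close>; the case of
    \<open>l\<close> is symmetric.\<close>
  then have "\<beta> - \<alpha> \<in> \<Phi> \<or> \<alpha> - \<beta> \<in> \<Phi>"
    using reflection_root[of \<alpha> \<beta>] reflection_root[of \<beta> \<alpha>] assms(1,2) k l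
    by (auto simp: root_reflection_def)
  then show ?thesis
    using pos_or_neg[of "\<beta> - \<alpha>"] pos_or_neg[of "\<alpha> - \<beta>"] by auto
qed

text \<open>This is the height of a root: the linear functional with value 1 on each simple root.
  Integrality comes from the integer expansion of roots, nonnegativity from the real coefficients in
  \<open>root_le\<close>, and a nonzero nonnegative integer is at least 1.\<close>

lemma obtain_height:
  obtains ht :: "'a \<Rightarrow> real" where "linear ht" "\<And>\<alpha>. \<alpha> \<in> pos \<Longrightarrow> ht \<alpha> \<ge> 1"
    "\<And>\<alpha>. \<alpha> \<in> pos \<Longrightarrow> ht \<alpha> \<in> \<int>"
proof -
  obtain ht :: "'a \<Rightarrow> real" where ht: "linear ht" "\<And>\<delta>. \<delta> \<in> \<Delta> \<Longrightarrow> ht \<delta> = 1"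
    using linear_independent_extend[OF independent_simple, of "\<lambda>_. 1 :: real"] by blast
  have sum_ht: "ht (\<Sum>\<delta>\<in>\<Delta>. c \<delta> *\<^sub>R \<delta>) = (\<Sum>\<delta>\<in>\<Delta>. c \<delta>)" for c
    by (simp add: linear_sum[OF ht(1)] linear_scale[OF ht(1)] ht(2))
  have int: "ht \<alpha> \<in> \<int>" if \<alpha>: "\<alpha> \<in> pos" for \<alpha>
  proof -
    obtain c :: "'a \<Rightarrow> int" where c: "\<alpha> = (\<Sum>\<delta>\<in>\<Delta>. of_int (c \<delta>) *\<^sub>R \<delta>)"
      using root_expansion[OF pos_root[OF \<alpha>]] by metis
    show ?thesis by (subst c) (auto simp: sum_ht intro!: Ints_sum)
  qed
  have "ht \<alpha> \<ge> 1" if \<alpha>: "\<alpha> \<in> pos" for \<alpha>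
  proof -
    obtain c :: "'a \<Rightarrow> real" where c: "\<forall>\<delta>\<in>\<Delta>. c \<delta> \<ge> 0" "\<alpha> = (\<Sum>\<delta>\<in>\<Delta>. c \<delta> *\<^sub>R \<delta>)"
      using pos_ge_0[OF \<alpha>] by (auto simp: root_le_def)
    have h: "ht \<alpha> = (\<Sum>\<delta>\<in>\<Delta>. c \<delta>)" by (simp add: c(2) sum_ht)
    then have "ht \<alpha> \<ge> 0" by (simp add: c(1) sum_nonneg)
    moreover have "ht \<alpha> \<noteq> 0"
    proof
      assume "ht \<alpha> = 0"
      then have "\<forall>\<delta>\<in>\<Delta>. c \<delta> = 0" using h c(1) finite_simple by (simp add: sum_nonneg_eq_0_iff)
      then have "\<alpha> = 0" using c(2) by simp
      then show False using \<alpha> pos_root zero_not_root by blast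
    qed
    ultimately show ?thesis using int[OF \<alpha>] by (auto elim!: Ints_cases)
  qed
  then show ?thesis using that ht(1) int by blast
qed

end

section \<open>Relations between sums of positive roots\<close>

lemma inner_sum_mset_pos:
  fixes x :: "'a::real_inner"
  assumes "x \<bullet> \<Sum>\<^sub># M > 0"
  obtains y where "y \<in># M" "x \<bullet> y > 0"
proof -
  have "\<exists>y\<in>#M. x \<bullet> y > 0" using assms
    by (induction M) (auto simp: inner_add_right, smt (verit))
  then show ?thesis using that by blast
qed

context simple_root_system begin

lemma ht_sum_mset_ge:
  assumes "linear (ht :: 'a \<Rightarrow> real)" "\<And>\<alpha>. \<alpha> \<in> pos \<Longrightarrow> ht \<alpha> \<ge> 1" "set_mset M \<subseteq> pos"
  shows "ht (\<Sum>\<^sub># M) \<ge> size M"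
  using assms(3)
proof (induction M)
  case (add x M)
  then show ?case using assms(2)[of x] by (simp add: linear_add[OF assms(1)])
qed (simp add: linear_0[OF assms(1)])

text \<open>The height of such a sum is at least the number of summands.\<close>

lemma sum_mset_pos_neq_0:
  assumes "set_mset M \<subseteq> pos" "M \<noteq> {#}"
  shows "\<Sum>\<^sub># M \<noteq> 0"
proof
  assume 0: "\<Sum>\<^sub># M = 0"
  obtain ht :: "'a \<Rightarrow> real" where "linear ht" "\<And>\<alpha>. \<alpha> \<in> pos \<Longrightarrow> ht \<alpha> \<ge> 1"
    "\<And>\<alpha>. \<alpha> \<in> pos \<Longrightarrow> ht \<alpha> \<in> \<int>"
    using obtain_height by blast
  then have "size M \<le> 0" using ht_sum_mset_ge[OF _ _ assms(1), of ht] 0 by (simp add: linear_0)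
  then show False using assms(2) by simp
qed

text \<open>
  Some \<open>\<beta> \<in> B\<close> has positive inner product with the common sum, hence with some \<open>\<gamma> \<in> A + D\<close>, so
  \<open>\<beta> - \<gamma>\<close> is zero or a root up to sign. Either we are done, or subtracting \<open>\<gamma>\<close> from \<open>\<beta>\<close>, or
  \<open>\<beta>\<close> from \<open>\<gamma>\<close>, gives a similar relation with a smaller right-hand side.
\<close>
lemma comparable_of_sum_eq:
  assumes "set_mset A \<subseteq> pos" "set_mset B \<subseteq> pos" "set_mset D \<subseteq> pos"
    and "\<Sum>\<^sub># A + \<Sum>\<^sub># D = \<Sum>\<^sub># B" "size B \<le> size A" "B \<noteq> {#}"
  shows "\<exists>\<alpha>\<in>#A. \<exists>\<beta>\<in>#B. root_le \<Delta> \<alpha> \<beta>"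
proof -
  obtain ht :: "'a \<Rightarrow> real" where lin: "linear ht" and ht1: "\<And>\<alpha>. \<alpha> \<in> pos \<Longrightarrow> ht \<alpha> \<ge> 1"
    and int: "\<And>\<alpha>. \<alpha> \<in> pos \<Longrightarrow> ht \<alpha> \<in> \<int>"
    using obtain_height by blast
  note ht_simps = linear_add[OF lin] linear_diff[OF lin] linear_0[OF lin]
  have sum_ge: "ht (\<Sum>\<^sub># M) \<ge> size M" if "set_mset M \<subseteq> pos" for M
    using ht_sum_mset_ge[OF lin _ that] ht1 by simp
  \<comment> \<open>Each reduced relation must again have a nonempty right-hand side. This follows
    once its left-hand side is nonempty, since sums of positive roots do not vanish.\<close>
  have nonempty: "B' \<noteq> {#}"
    if "set_mset A' \<subseteq> pos" "set_mset D' \<subseteq> pos" "\<Sum>\<^sub># A' + \<Sum>\<^sub># D' = \<Sum>\<^sub># B'"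
      "A' \<noteq> {#} \<or> D' \<noteq> {#}" for A' B' D'
    using sum_mset_pos_neq_0[of "A' + D'"] that by auto
  \<comment> \<open>The induction runs on a bound for the height of the right-hand side. Every
    reduction removes a positive root from it and thus lowers the height by at least 1.\<close>
  obtain n :: nat where "ht (\<Sum>\<^sub># B) < n" using reals_Archimedean2 by blast
  then show ?thesis using assms
  proof (induction n arbitrary: A B D)
    case 0
    then show ?case using sum_ge[of B] by simp
  next
    case (Suc n)
    note A = Suc.prems(2) and B = Suc.prems(3) and D = Suc.prems(4)
      and eq = Suc.prems(5) and size = Suc.prems(6)
    let ?s = "\<Sum>\<^sub># B"
    have "ht ?s \<ge> size B" using sum_ge[OF B] .
    then have "ht ?s \<noteq> 0" using Suc.prems(7) by (simp add: nonempty_has_size)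
    then have "?s \<bullet> ?s > 0" using linear_0[OF lin] by auto
    then obtain \<beta> where \<beta>: "\<beta> \<in># B" "?s \<bullet> \<beta> > 0" using inner_sum_mset_pos by blast
    then have "\<beta> \<bullet> \<Sum>\<^sub># (A + D) > 0" by (simp add: eq inner_commute)
    then obtain \<gamma> where \<gamma>: "\<gamma> \<in># A + D" "\<beta> \<bullet> \<gamma> > 0" using inner_sum_mset_pos by blast
    have \<beta>p: "\<beta> \<in> pos" and \<gamma>p: "\<gamma> \<in> pos" using \<beta> \<gamma> A B D by auto
    obtain B' where B': "B = add_mset \<beta> B'" using multi_member_split[OF \<beta>(1)] by blast
    have smaller: "ht (\<Sum>\<^sub># B') < n"
      using Suc.prems(1) ht1[OF \<beta>p] by (simp add: B' ht_simps)
    consider "\<beta> = \<gamma>" | "\<gamma> - \<beta> \<in> pos" | "\<beta> - \<gamma> \<in> pos"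
      using root_diff[OF pos_root[OF \<beta>p] pos_root[OF \<gamma>p]] \<gamma>(2) by blast
    note diff_cases = this
    show ?case
    proof (cases "\<gamma> \<in># A")
      case True
      then obtain A' where A': "A = add_mset \<gamma> A'" by (blast dest: multi_member_split)
      show ?thesis
      proof (cases rule: diff_cases)
        case 1
        then show ?thesis using True \<beta>(1) root_le_refl[of \<Delta> \<gamma>] by (intro bexI[of _ \<gamma>]) auto
      next
        case 3
        then have "root_le \<Delta> \<gamma> \<beta>" using pos_ge_0 root_le_diff_iff by metis
        then show ?thesis using True \<beta>(1) by blast
      next
        case 2
        \<comment> \<open>The root \<open>\<gamma> - \<beta>\<close> moves to \<open>D\<close>,
          while \<open>A\<close> and \<open>B\<close> lose one element each, so the inequality
          between their sizes survives.\<close>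
        have eq': "\<Sum>\<^sub># A' + \<Sum>\<^sub># (add_mset (\<gamma> - \<beta>) D) = \<Sum>\<^sub># B'"
          using eq by (simp add: A' B' algebra_simps)
        have D': "set_mset (add_mset (\<gamma> - \<beta>) D) \<subseteq> pos" using D 2 by simp
        have "\<exists>\<alpha>\<in>#A'. \<exists>\<beta>\<in>#B'. root_le \<Delta> \<alpha> \<beta>"
          using nonempty[OF _ D' eq'] A B D size
          by (intro Suc.IH[OF smaller _ _ D' eq']) (auto simp: A' B')
        then show ?thesis by (auto simp: A' B')
      qed
    next
      case False
      then have "\<gamma> \<in># D" using \<gamma>(1) by simp
      then obtain D' where D': "D = add_mset \<gamma> D'" by (blast dest: multi_member_split)
      \<comment> \<open>As \<open>A\<close> is at least as large as the nonempty \<open>B\<close>,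
        it keeps the left-hand side nonempty while only \<open>D\<close> is changed.\<close>
      have A_ne: "A \<noteq> {#}" using size Suc.prems(7) by auto
      show ?thesis
      proof (cases rule: diff_cases)
        case 1
        have eq': "\<Sum>\<^sub># A + \<Sum>\<^sub># D' = \<Sum>\<^sub># B'" using eq 1 by (simp add: D' B' algebra_simps)
        have "\<exists>\<alpha>\<in>#A. \<exists>\<beta>\<in>#B'. root_le \<Delta> \<alpha> \<beta>"
          using nonempty[OF A _ eq'] A_ne A B D size
          by (intro Suc.IH[OF smaller _ _ _ eq']) (auto simp: D' B')
        then show ?thesis by (auto simp: B')
      next
        case 2
        have eq': "\<Sum>\<^sub># A + \<Sum>\<^sub># (add_mset (\<gamma> - \<beta>) D') = \<Sum>\<^sub># B'"
          using eq by (simp add: D' B' algebra_simps)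
        have "\<exists>\<alpha>\<in>#A. \<exists>\<beta>\<in>#B'. root_le \<Delta> \<alpha> \<beta>"
          using nonempty[OF A _ eq'] A_ne A B D size 2
          by (intro Suc.IH[OF smaller _ _ _ eq']) (auto simp: D' B')
        then show ?thesis by (auto simp: B')
      next
        case 3
        have eq': "\<Sum>\<^sub># A + \<Sum>\<^sub># D' = \<Sum>\<^sub># (add_mset (\<beta> - \<gamma>) B')"
          using eq by (simp add: D' B' algebra_simps)
        have "ht (\<Sum>\<^sub># (add_mset (\<beta> - \<gamma>) B')) < n"
          using Suc.prems(1) ht1[OF \<gamma>p] by (simp add: B' ht_simps)
        then have "\<exists>\<alpha>\<in>#A. \<exists>\<beta>\<in>#add_mset (\<beta> - \<gamma>) B'. root_le \<Delta> \<alpha> \<beta>"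
          using A B D size 3 by (intro Suc.IH[OF _ _ _ _ eq']) (auto simp: D' B')
        \<comment> \<open>The new element \<open>\<beta> - \<gamma>\<close> need not belong to the
          original \<open>B\<close>, but it lies below \<open>\<beta>\<close>, which does.\<close>
        moreover have "root_le \<Delta> \<alpha> \<beta>" if "root_le \<Delta> \<alpha> (\<beta> - \<gamma>)" for \<alpha>
          using root_le_trans[OF that] pos_ge_0[OF \<gamma>p] root_le_diff_iff[of \<Delta> \<beta> "\<beta> - \<gamma>"] by simp
        ultimately show ?thesis by (auto simp: B')
      qed
    qed
  qed
qed

end

section \<open>Regions of the Shi arrangement\<close>

text \<open>
  Dirichlet approximation turns real weights into nearby integer weights after scaling; a value of
  an integral functional that is smaller than \<open>1\<close> in absolute value vanishes.
\<close>
lemma integral_weights: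
  fixes F :: "'v::real_vector set" and G :: "('v \<Rightarrow> real) set"
  assumes fin: "finite F" "finite G"
    and lin: "\<And>g. g \<in> G \<Longrightarrow> linear g"
    and int: "\<And>g v. g \<in> G \<Longrightarrow> v \<in> F \<Longrightarrow> g v \<in> \<int>"
    and sep: "\<And>v. (\<And>g. g \<in> G \<Longrightarrow> g v = 0) \<Longrightarrow> v = 0"
    and u: "\<And>v. v \<in> F \<Longrightarrow> u v \<ge> 0" "(\<Sum>v\<in>F. u v) = 1" "(\<Sum>v\<in>F. u v *\<^sub>R v) = 0"
  obtains M where "set_mset M \<subseteq> F" "M \<noteq> {#}" "\<Sum>\<^sub># M = 0"
proof -
  \<comment> \<open>Simultaneous approximation is indexed by an initial segment of the naturals,
    hence the enumeration of \<open>F\<close>.\<close>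
  obtain e where e: "bij_betw e {0..<card F} F" using ex_bij_betw_nat_finite fin(1) by blast
  define e' where "e' = the_inv_into {0..<card F} e"
  have e': "e' v < card F" "e (e' v) = v" if "v \<in> F" for v
    using bij_betw_apply[OF bij_betw_the_inv_into[OF e] that] that
      f_the_inv_into_f_bij_betw[OF e] by (auto simp: e'_def)
  obtain K :: nat where K: "real (card F) + (\<Sum>g\<in>G. \<Sum>v\<in>F. \<bar>g v\<bar>) < K"
    using reals_Archimedean2 by blast
  have sums_ge: "(\<Sum>g\<in>G. \<Sum>v\<in>F. \<bar>g v\<bar>) \<ge> 0" by (intro sum_nonneg) auto
  have "real K > 0" using K sums_ge by (smt (verit) of_nat_0_le_iff)
  then have K0: "K > 0" by simp
  obtain q p' where q: "0 < q" and p': "\<And>i. i < card F \<Longrightarrow> \<bar>of_int q * u (e i) - of_int (p' i)\<bar> < 1 / K"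
    using Dirichlet_approx_simult[OF K0, of "card F" "\<lambda>i. u (e i)"] by metis
  define p where "p v = p' (e' v)" for v
  have p: "\<bar>of_int q * u v - of_int (p v)\<bar> < 1 / K" if "v \<in> F" for v
    using p'[OF e'(1)[OF that]] e'(2)[OF that] by (simp add: p_def)
  have p_nonneg: "p v \<ge> 0" if "v \<in> F" for v
  proof -
    have "1 / real K \<le> 1" using K0 by simp
    moreover have "of_int q * u v \<ge> 0" using q u(1)[OF that] by simp
    ultimately have "real_of_int (p v) > - 1" using p[OF that] by linarith
    then show ?thesis by linarith
  qed
  \<comment> \<open>The scaled real weights add up to \<open>q\<close>, which is at least 1, and
    rounding changes the total by less than 1.\<close>
  have sum_p: "(\<Sum>v\<in>F. p v) > 0"
  proof -
    have "of_int q - (\<Sum>v\<in>F. of_int (p v)) = (\<Sum>v\<in>F. of_int q * u v - of_int (p v))"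
      by (simp add: sum_subtractf sum_distrib_left[symmetric] u(2))
    also have "\<dots> \<le> (\<Sum>v\<in>F. 1 / K)" using p by (intro sum_mono) (smt (verit))
    also have "\<dots> = card F / K" by simp
    also have "\<dots> < 1" using K K0 sums_ge by (simp add: divide_less_eq)
    finally have "real_of_int (\<Sum>v\<in>F. p v) > of_int q - 1" by simp
    then show ?thesis using q by linarith
  qed
  have zero: "(\<Sum>v\<in>F. of_int (p v) *\<^sub>R v) = 0" (is "?s = 0")
  proof (rule sep)
    fix g assume g: "g \<in> G"
    have g_s: "g ?s = (\<Sum>v\<in>F. of_int (p v) * g v)"
      by (simp add: linear_sum[OF lin[OF g]] linear_scale[OF lin[OF g]])
    then have "g ?s \<in> \<int>" using int[OF g] by (auto intro!: Ints_sum Ints_mult)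
    have "(\<Sum>v\<in>F. u v * g v) = g (\<Sum>v\<in>F. u v *\<^sub>R v)"
      by (simp add: linear_sum[OF lin[OF g]] linear_scale[OF lin[OF g]])
    also have "\<dots> = 0" by (simp add: u(3) linear_0[OF lin[OF g]])
    \<comment> \<open>Because \<open>u\<close> gives an exact relation, only the approximation
      errors contribute to the value of \<open>g\<close>.\<close>
    finally have "g ?s = - (\<Sum>v\<in>F. (of_int q * u v - of_int (p v)) * g v)"
      by (simp add: g_s left_diff_distrib sum_subtractf mult.assoc sum_distrib_left[symmetric])
    then have "\<bar>g ?s\<bar> \<le> (\<Sum>v\<in>F. \<bar>(of_int q * u v - of_int (p v)) * g v\<bar>)" by simp
    also have "\<dots> \<le> (\<Sum>v\<in>F. 1 / K * \<bar>g v\<bar>)"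
      unfolding abs_mult using p by (intro sum_mono mult_right_mono) (auto intro: less_imp_le)
    also have "\<dots> = (\<Sum>v\<in>F. \<bar>g v\<bar>) / K" by (simp add: sum_divide_distrib)
    also have "\<dots> < 1"
    proof -
      have "(\<Sum>v\<in>F. \<bar>g v\<bar>) \<le> (\<Sum>g\<in>G. \<Sum>v\<in>F. \<bar>g v\<bar>)"
        by (rule member_le_sum[OF g _ fin(2)]) (auto intro: sum_nonneg)
      also have "\<dots> < K" using K by (smt (verit) of_nat_0_le_iff)
      finally show ?thesis using K0 by simp
    qed
    finally show "g ?s = 0" using \<open>g ?s \<in> \<int>\<close> by (auto elim!: Ints_cases)
  qed
  define M where "M = (\<Sum>v\<in>F. replicate_mset (nat (p v)) v)"
  have set_M: "set_mset (\<Sum>v\<in>F'. replicate_mset (nat (p v)) v) \<subseteq> F'" if "finite F'" for F'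
    using that by induction (auto split: if_splits)
  have size_M: "size (\<Sum>v\<in>F'. replicate_mset (nat (p v)) v) = (\<Sum>v\<in>F'. nat (p v))"
    if "finite F'" for F'
    using that by induction auto
  have sum_rep: "\<Sum>\<^sub># (replicate_mset n v) = real n *\<^sub>R v" for n and v :: 'v
    by (induction n) (auto simp: scaleR_add_left)
  have sum_M: "\<Sum>\<^sub># (\<Sum>v\<in>F'. replicate_mset (nat (p v)) v) = (\<Sum>v\<in>F'. real (nat (p v)) *\<^sub>R v)"
    if "finite F'" for F'
    using that by induction (auto simp: sum_rep)
  show thesis
  proof (rule that)
    show "set_mset M \<subseteq> F" unfolding M_def using set_M fin(1) .
    have "int (size M) = (\<Sum>v\<in>F. p v)"
      unfolding M_def size_M[OF fin(1)] by (simp add: p_nonneg)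
    then show "M \<noteq> {#}" using sum_p by auto
    have "\<Sum>\<^sub># M = (\<Sum>v\<in>F. of_int (p v) *\<^sub>R v)"
      unfolding M_def sum_M[OF fin(1)] by (intro sum.cong) (auto simp: p_nonneg)
    then show "\<Sum>\<^sub># M = 0" using zero by simp
  qed
qed

section \<open>Simple-root coordinates and nonemptiness of the regions\<close>

context simple_root_system begin

lemma span_simple: "span \<Delta> = UNIV"
proof -
  have "\<Phi> \<subseteq> span \<Delta>"
  proof
    fix \<beta> assume "\<beta> \<in> \<Phi>"
    then obtain c :: "'a \<Rightarrow> int" where c: "\<beta> = (\<Sum>\<delta>\<in>\<Delta>. of_int (c \<delta>) *\<^sub>R \<delta>)"
      by (rule root_expansion)
    show "\<beta> \<in> span \<Delta>" unfolding c by (intro span_sum span_scale span_base)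
  qed
  then have "span \<Phi> \<subseteq> span \<Delta>" by (simp add: span_minimal)
  then show ?thesis using span_roots by auto
qed

lemma linear_representation: "linear (\<lambda>v. representation \<Delta> v \<delta>)"
proof (rule linearI)
  have span: "x \<in> span \<Delta>" for x by (simp add: span_simple)
  show "representation \<Delta> (x + y) \<delta> = representation \<Delta> x \<delta> + representation \<Delta> y \<delta>" for x y
    using fun_cong[OF representation_add[OF independent_simple span span]] .
  show "representation \<Delta> (c *\<^sub>R x) \<delta> = c *\<^sub>R representation \<Delta> x \<delta>" for c x
    using fun_cong[OF representation_scale[OF independent_simple span]] by (simp only: real_scaleR_def)
qed

text \<open>Coordinates are linear and give 0 or 1 on simple roots, so an integer expansion has
  integer coordinates. This supplies the integrality required by
  \<open>integral_weights\<close>.\<close>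

lemma representation_root_Ints:
  assumes "\<beta> \<in> \<Phi>"
  shows "representation \<Delta> \<beta> \<delta> \<in> \<int>"
proof -
  obtain c :: "'a \<Rightarrow> int" where c: "\<beta> = (\<Sum>\<delta>\<in>\<Delta>. of_int (c \<delta>) *\<^sub>R \<delta>)"
    using assms by (rule root_expansion)
  show ?thesis
    unfolding c linear_sum[OF linear_representation] linear_scale[OF linear_representation]
    by (intro Ints_sum) (auto simp: representation_basis independent_simple)
qed

lemma representation_eq_0_imp:
  assumes "\<And>\<delta>. \<delta> \<in> \<Delta> \<Longrightarrow> representation \<Delta> v \<delta> = 0"
  shows "v = 0"
proof -
  have "(\<Sum>b | representation \<Delta> v b \<noteq> 0. representation \<Delta> v b *\<^sub>R b) = v"
    by (rule sum_nonzero_representation_eq) (simp_all add: independent_simple span_simple)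
  moreover have "{b. representation \<Delta> v b \<noteq> 0} = {}"
    using assms representation_ne_zero by blast
  ultimately show ?thesis by simp
qed

text \<open>
  By Gordan's theorem, a system without solution yields a relation with nonnegative weights,
  which can be taken integral; it is excluded by \<open>comparable_of_sum_eq\<close>.
\<close>
theorem shi_region_nonempty:
  assumes I: "I \<subseteq> pos" and up: "\<And>\<alpha> \<beta>. \<alpha> \<in> I \<Longrightarrow> \<beta> \<in> pos \<Longrightarrow> root_le \<Delta> \<alpha> \<beta> \<Longrightarrow> \<beta> \<in> I"
  obtains x where "\<And>\<alpha>. \<alpha> \<in> pos \<Longrightarrow> \<alpha> \<bullet> x > 0" "\<And>\<alpha>. \<alpha> \<in> I \<Longrightarrow> \<alpha> \<bullet> x > 1"
    "\<And>\<alpha>. \<alpha> \<in> pos - I \<Longrightarrow> \<alpha> \<bullet> x < 1"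
proof -
  \<comment> \<open>Pairing with \<open>(y, t)\<close> homogenizes the inequalities for
    \<open>x = y / t\<close>. The first three families encode values above 1, below 1 and above 0;
    the vector \<open>(0, 1)\<close> encodes positivity of \<open>t\<close>.\<close>
  define F :: "('a \<times> real) set" where
    "F = (\<lambda>\<alpha>. (\<alpha>, -1)) ` I \<union> (\<lambda>\<alpha>. (- \<alpha>, 1)) ` (pos - I) \<union> (\<lambda>\<alpha>. (\<alpha>, 0)) ` pos \<union> {(0, 1)}"
  have fin: "finite F" unfolding F_def using finite_pos I by (auto intro: finite_subset)
  have "0 \<notin> convex hull F"
  proof
    assume "0 \<in> convex hull F"
    then obtain u where u: "\<forall>v\<in>F. 0 \<le> u v" "sum u F = 1" "(\<Sum>v\<in>F. u v *\<^sub>R v) = 0"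
      unfolding convex_hull_finite[OF fin] by auto
    \<comment> \<open>The simple-root coordinates of the first component, together with the second
      component, are integral on \<open>F\<close> and jointly separate points.\<close>
    define G :: "('a \<times> real \<Rightarrow> real) set" where
      "G = insert snd ((\<lambda>\<delta> v. representation \<Delta> (fst v) \<delta>) ` \<Delta>)"
    have G_int: "g v \<in> \<int>" if "g \<in> G" "v \<in> F" for g v
      using that I
      by (auto simp: G_def F_def representation_root_Ints pos_root representation_zero
        linear_neg[OF linear_representation])
    have G_lin: "linear g" if "g \<in> G" for g
      using that linear_compose[OF linear_fst linear_representation]
      by (auto simp: G_def linear_snd o_def)
    have G_sep: "v = 0" if "\<And>g. g \<in> G \<Longrightarrow> g v = 0" for v
    proof -
      have "snd v = 0" using that[of snd] by (simp add: G_def)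
      moreover have "fst v = 0"
      proof (rule representation_eq_0_imp)
        fix \<delta> assume "\<delta> \<in> \<Delta>"
        then show "representation \<Delta> (fst v) \<delta> = 0"
          using that[of "\<lambda>v. representation \<Delta> (fst v) \<delta>"] by (auto simp: G_def)
      qed
      ultimately show ?thesis by (simp add: prod_eq_iff)
    qed
    have "finite G" using finite_simple by (simp add: G_def)
    then obtain M where M: "set_mset M \<subseteq> F" "M \<noteq> {#}" "\<Sum>\<^sub># M = 0"
      using u by (elim integral_weights[OF fin]) (auto intro: G_lin G_int G_sep)
    \<comment> \<open>The elements of \<open>M\<close> are sorted by the four kinds of vectors in
      \<open>F\<close>, with \<open>k\<close> counting the copies of \<open>(0, 1)\<close>.
      Vanishing of the sum then yields a relation between roots and, in the second component,
      \<open>size B + k = size A\<close>.\<close>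
    have "\<exists>A B D k. set_mset A \<subseteq> I \<and> set_mset B \<subseteq> pos - I \<and> set_mset D \<subseteq> pos \<and>
        size M = size A + size B + size D + k \<and>
        \<Sum>\<^sub># M = (\<Sum>\<^sub># A + \<Sum>\<^sub># D - \<Sum>\<^sub># B, real (size B) + real k - real (size A))"
      using M(1)
    proof (induction M)
      case empty
      show ?case
        by (intro exI[of _ "{#}"] exI[of _ 0]) (simp add: zero_prod_def)
    next
      case (add v M)
      then obtain A B D k where IH: "set_mset A \<subseteq> I" "set_mset B \<subseteq> pos - I" "set_mset D \<subseteq> pos"
        "size M = size A + size B + size D + k"
        "\<Sum>\<^sub># M = (\<Sum>\<^sub># A + \<Sum>\<^sub># D - \<Sum>\<^sub># B, real (size B) + real k - real (size A))"
        by auto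
      consider \<alpha> where "\<alpha> \<in> I" "v = (\<alpha>, -1)" | \<alpha> where "\<alpha> \<in> pos - I" "v = (- \<alpha>, 1)"
        | \<alpha> where "\<alpha> \<in> pos" "v = (\<alpha>, 0)" | "v = (0, 1)"
        using add.prems by (auto simp: F_def)
      then show ?case
      proof cases
        case 1
        then show ?thesis using IH
          by (intro exI[of _ "add_mset \<alpha> A"] exI[of _ B] exI[of _ D] exI[of _ k]) auto
      next
        case 2
        then show ?thesis using IH
          by (intro exI[of _ A] exI[of _ "add_mset \<alpha> B"] exI[of _ D] exI[of _ k]) auto
      next
        case 3
        then show ?thesis using IH
          by (intro exI[of _ A] exI[of _ B] exI[of _ "add_mset \<alpha> D"] exI[of _ k]) auto
      next
        case 4
        then show ?thesis using IH
          by (intro exI[of _ A] exI[of _ B] exI[of _ D] exI[of _ "Suc k"]) auto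
      qed
    qed
    then obtain A B D k where A: "set_mset A \<subseteq> I" and B: "set_mset B \<subseteq> pos - I"
      and D: "set_mset D \<subseteq> pos" and size: "size M = size A + size B + size D + k"
      and sums: "\<Sum>\<^sub># M = (\<Sum>\<^sub># A + \<Sum>\<^sub># D - \<Sum>\<^sub># B, real (size B) + real k - real (size A))"
      by blast
    have eq: "\<Sum>\<^sub># A + \<Sum>\<^sub># D = \<Sum>\<^sub># B" and "real (size B) + real k = real (size A)"
      using sums M(3) by (auto simp: zero_prod_def)
    then have sizes: "size B + k = size A" by linarith
    have Ap: "set_mset A \<subseteq> pos" and Bp: "set_mset B \<subseteq> pos" using A B I by auto
    show False
    \<comment> \<open>If \<open>B\<close> is empty then \<open>k = size A\<close>, so nonemptiness
      of \<open>M\<close> leaves a nonempty multiset of positive roots with sum 0. Otherwise two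
      comparable roots contradict the upward closure of \<open>I\<close>.\<close>
    proof (cases "B = {#}")
      case True
      then have "A + D \<noteq> {#}" using sizes size M(2) by auto
      moreover have "\<Sum>\<^sub># (A + D) = 0" using eq True by simp
      moreover have "set_mset (A + D) \<subseteq> pos" using Ap D by simp
      ultimately show False using sum_mset_pos_neq_0 by blast
    next
      case False
      then obtain \<alpha> \<beta> where "\<alpha> \<in># A" "\<beta> \<in># B" "root_le \<Delta> \<alpha> \<beta>"
        using comparable_of_sum_eq[OF Ap Bp D eq] sizes by auto
      then show False using up A B by blast
    qed
  qed
  \<comment> \<open>The convex hull of a finite set is compact, so it is strictly separated from 0
    by a hyperplane; the normal vector \<open>a\<close> is then positive on all of
    \<open>F\<close>.\<close>
  then obtain a b where ab: "0 < b" "\<And>v. v \<in> convex hull F \<Longrightarrow> a \<bullet> v > b"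
    using separating_hyperplane_closed_0[of "convex hull F"] fin
    by (auto simp: compact_imp_closed finite_imp_compact_convex_hull)
  obtain y t where a: "a = (y, t)" by (cases a)
  have F_pos: "y \<bullet> fst v + t * snd v > 0" if "v \<in> F" for v
    using ab(1) ab(2)[OF hull_inc[OF that]] by (cases v) (auto simp: a)
  have t: "t > 0" using F_pos[of "(0, 1)"] by (simp add: F_def)
  show thesis
  proof (rule that[of "y /\<^sub>R t"])
    fix \<alpha> assume "\<alpha> \<in> pos"
    then show "\<alpha> \<bullet> (y /\<^sub>R t) > 0" using t F_pos[of "(\<alpha>, 0)"] by (auto simp: F_def inner_commute)
  next
    fix \<alpha> assume "\<alpha> \<in> I"
    then show "\<alpha> \<bullet> (y /\<^sub>R t) > 1" using t F_pos[of "(\<alpha>, -1)"]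
      by (auto simp: F_def inner_commute field_simps)
  next
    fix \<alpha> assume "\<alpha> \<in> pos - I"
    then show "\<alpha> \<bullet> (y /\<^sub>R t) < 1" using t F_pos[of "(- \<alpha>, 1)"]
      by (auto simp: F_def inner_commute field_simps)
  qed
qed

end

section \<open>Polynomials modulo the relations of a preorder\<close>

lemma poly_mapping_eq_sum_single:
  "f = (\<Sum>k\<in>Poly_Mapping.keys f. Poly_Mapping.single k (Poly_Mapping.lookup f k))"
proof (rule poly_mapping_eqI)
  fix k
  show "Poly_Mapping.lookup f k =
    Poly_Mapping.lookup (\<Sum>k\<in>Poly_Mapping.keys f. Poly_Mapping.single k (Poly_Mapping.lookup f k)) k"
    by (simp add: lookup_sum lookup_single when_def in_keys_iff)
qed

lemma single_sum: "Poly_Mapping.single k (sum f A) = (\<Sum>a\<in>A. Poly_Mapping.single k (f a))"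
  by (induction A rule: infinite_finite_induct) (auto simp: single_add)

lemma keys_add_nat:
  "Poly_Mapping.keys (m + n :: 'v \<Rightarrow>\<^sub>0 nat) = Poly_Mapping.keys m \<union> Poly_Mapping.keys n"
  by (auto simp: in_keys_iff lookup_add)

lemma keys_sum_nat:
  "finite A \<Longrightarrow> Poly_Mapping.keys (\<Sum>a\<in>A. f a :: 'v \<Rightarrow>\<^sub>0 nat) = (\<Union>a\<in>A. Poly_Mapping.keys (f a))"
  by (induction A rule: finite_induct) (auto simp: keys_add_nat)

text \<open>Evaluation at the \<open>0\<close>-\<open>1\<close>-vector with support \<open>I\<close>.\<close>
definition eval_at :: "'v set \<Rightarrow> 'v int_mpoly \<Rightarrow> int" where
  "eval_at I p =
     (\<Sum>m\<in>Poly_Mapping.keys p. if Poly_Mapping.keys m \<subseteq> I then Poly_Mapping.lookup p m else 0)"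

lemma eval_at_add: "eval_at I (p + q) = eval_at I p + eval_at I q"
  unfolding eval_at_def
  by (rule setsum_keys_plus_distrib[where f = "\<lambda>m c. if Poly_Mapping.keys m \<subseteq> I then c else 0"]) auto

lemma eval_at_single:
  "eval_at I (Poly_Mapping.single m c) = (if Poly_Mapping.keys m \<subseteq> I then c else 0)"
  by (simp add: eval_at_def)

lemma eval_at_0: "eval_at I 0 = 0"
  by (simp add: eval_at_def)

lemma eval_at_1: "eval_at I 1 = 1"
  by (simp add: eval_at_def)

lemma eval_at_var: "eval_at I (var v) = (if v \<in> I then 1 else 0)"
  by (simp add: var_def eval_at_single)

lemma eval_at_sum: "eval_at I (sum f A) = (\<Sum>a\<in>A. eval_at I (f a))"
  by (induction A rule: infinite_finite_induct) (auto simp: eval_at_0 eval_at_add)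

text \<open>A monomial contributes at \<open>I\<close> iff its variables lie in \<open>I\<close>,
  and the variables of a product of monomials form the union. So the indicator \<open>c\<close> is
  multiplicative, and both sides expand to the same double sum.\<close>

lemma eval_at_mult: "eval_at I (p * q) = eval_at I p * eval_at I q"
proof -
  define c where "c m = (if Poly_Mapping.keys m \<subseteq> I then 1 else 0 :: int)" for m :: "'a \<Rightarrow>\<^sub>0 nat"
  have ev: "eval_at I p = (\<Sum>m\<in>Poly_Mapping.keys p. Poly_Mapping.lookup p m * c m)" for p
    unfolding eval_at_def c_def by (intro sum.cong) auto
  have c_add: "c (m + n) = c m * c n" for m n by (auto simp: c_def keys_add_nat)
  have ev_single: "eval_at I (Poly_Mapping.single m a) = a * c m" for m a
    by (simp add: eval_at_single c_def)
  have "p * q = (\<Sum>m\<in>Poly_Mapping.keys p. \<Sum>n\<in>Poly_Mapping.keys q.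
      Poly_Mapping.single (m + n) (Poly_Mapping.lookup p m * Poly_Mapping.lookup q n))"
    by (subst (1) poly_mapping_eq_sum_single[of p], subst (1) poly_mapping_eq_sum_single[of q])
      (simp add: sum_product mult_single)
  then have "eval_at I (p * q) = (\<Sum>m\<in>Poly_Mapping.keys p. \<Sum>n\<in>Poly_Mapping.keys q.
      (Poly_Mapping.lookup p m * c m) * (Poly_Mapping.lookup q n * c n))"
    by (simp add: eval_at_sum ev_single c_add algebra_simps)
  then show ?thesis by (simp add: ev sum_product)
qed

lemma eval_at_uminus: "eval_at I (- p) = - eval_at I p"
  using eval_at_add[of I p "- p"] by (simp add: eval_at_0)

lemma eval_at_diff: "eval_at I (p - q) = eval_at I p - eval_at I q"
  using eval_at_add[of I p "- q"] by (simp add: eval_at_uminus)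

lemma eval_at_prod: "eval_at I (prod f A) = (\<Prod>a\<in>A. eval_at I (f a))"
  by (induction A rule: infinite_finite_induct) (auto simp: eval_at_1 eval_at_mult)

section \<open>The integer polynomial ring and its generation by variables\<close>

lemma int_poly_carrier_iff:
  "p \<in> carrier (int_poly_ring S) \<longleftrightarrow> (\<forall>m\<in>Poly_Mapping.keys p. Poly_Mapping.keys m \<subseteq> S)"
  by (simp add: int_poly_ring_def)

lemma int_poly_ring_ops:
  "mult (int_poly_ring S) = (*)" "one (int_poly_ring S) = 1"
  "zero (int_poly_ring S) = 0" "add (int_poly_ring S) = (+)"
  by (simp_all add: int_poly_ring_def)

lemma int_poly_carrier:
  "0 \<in> carrier (int_poly_ring S)" "1 \<in> carrier (int_poly_ring S)"
  "v \<in> S \<Longrightarrow> var v \<in> carrier (int_poly_ring S)"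
  "p \<in> carrier (int_poly_ring S) \<Longrightarrow> q \<in> carrier (int_poly_ring S) \<Longrightarrow> p + q \<in> carrier (int_poly_ring S)"
  "p \<in> carrier (int_poly_ring S) \<Longrightarrow> - p \<in> carrier (int_poly_ring S)"
  "p \<in> carrier (int_poly_ring S) \<Longrightarrow> q \<in> carrier (int_poly_ring S) \<Longrightarrow> p - q \<in> carrier (int_poly_ring S)"
  "p \<in> carrier (int_poly_ring S) \<Longrightarrow> q \<in> carrier (int_poly_ring S) \<Longrightarrow> p * q \<in> carrier (int_poly_ring S)"
proof -
  interpret cring "int_poly_ring S" by (rule int_poly_ring_cring)
  show "0 \<in> carrier (int_poly_ring S)" "1 \<in> carrier (int_poly_ring S)"
    "v \<in> S \<Longrightarrow> var v \<in> carrier (int_poly_ring S)"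
    by (simp_all add: int_poly_carrier_iff var_def)
  show add: "p \<in> carrier (int_poly_ring S) \<Longrightarrow> q \<in> carrier (int_poly_ring S) \<Longrightarrow> p + q \<in> carrier (int_poly_ring S)" for p q
    using add.m_closed[of p q] by (simp add: int_poly_ring_ops)
  show neg: "p \<in> carrier (int_poly_ring S) \<Longrightarrow> - p \<in> carrier (int_poly_ring S)" for p
    by (simp add: int_poly_carrier_iff)
  show "p \<in> carrier (int_poly_ring S) \<Longrightarrow> q \<in> carrier (int_poly_ring S) \<Longrightarrow> p - q \<in> carrier (int_poly_ring S)"
    using add[of p "- q"] neg[of q] by simp
  show "p \<in> carrier (int_poly_ring S) \<Longrightarrow> q \<in> carrier (int_poly_ring S) \<Longrightarrow> p * q \<in> carrier (int_poly_ring S)"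
    using m_closed[of p q] by (simp add: int_poly_ring_ops)
qed

lemma single_in_int_poly_carrier:
  "Poly_Mapping.keys m \<subseteq> S \<Longrightarrow> Poly_Mapping.single m c \<in> carrier (int_poly_ring S)"
  by (simp add: int_poly_carrier_iff)

lemma int_poly_carrier_sum:
  "(\<And>a. a \<in> A \<Longrightarrow> f a \<in> carrier (int_poly_ring S)) \<Longrightarrow> sum f A \<in> carrier (int_poly_ring S)"
  by (induction A rule: infinite_finite_induct) (auto simp: int_poly_carrier)

lemma int_poly_carrier_prod:
  "(\<And>a. a \<in> A \<Longrightarrow> f a \<in> carrier (int_poly_ring S)) \<Longrightarrow> prod f A \<in> carrier (int_poly_ring S)"
  by (induction A rule: infinite_finite_induct) (auto simp: int_poly_carrier)

text \<open>The variables generate the ring. The proof climbs from powers of a variable to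
  monomials, then to integer multiples of monomials and finally to their sums.\<close>

lemma int_poly_ring_induct [consumes 1, case_names one var uminus add mult]:
  assumes "p \<in> carrier (int_poly_ring S)"
    and one: "P 1" and var: "\<And>v. v \<in> S \<Longrightarrow> P (var v)"
    and uminus: "\<And>p. p \<in> carrier (int_poly_ring S) \<Longrightarrow> P p \<Longrightarrow> P (- p)"
    and add: "\<And>p q. p \<in> carrier (int_poly_ring S) \<Longrightarrow> q \<in> carrier (int_poly_ring S) \<Longrightarrow>
      P p \<Longrightarrow> P q \<Longrightarrow> P (p + q)"
    and mult: "\<And>p q. p \<in> carrier (int_poly_ring S) \<Longrightarrow> q \<in> carrier (int_poly_ring S) \<Longrightarrow>
      P p \<Longrightarrow> P q \<Longrightarrow> P (p * q)"
  shows "P p"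
proof -
  let ?C = "carrier (int_poly_ring S)"
  note single = single_in_int_poly_carrier
  have zero: "P 0" using add[of 1 "-1"] uminus[of 1] one by (simp add: int_poly_carrier)
  have power: "P (Poly_Mapping.single (Poly_Mapping.single v k) 1)" if "v \<in> S" for v k
  proof (induction k)
    case 0
    then show ?case using one by (simp add: single_one)
  next
    case (Suc k)
    have "Poly_Mapping.single (Poly_Mapping.single v (Suc k)) 1 =
        var v * Poly_Mapping.single (Poly_Mapping.single v k) 1"
      by (simp add: var_def mult_single single_add[symmetric])
    then show ?case using that Suc var by (simp add: mult int_poly_carrier single)
  qed
  have "P (Poly_Mapping.single (\<Sum>v\<in>W. Poly_Mapping.single v (k v)) 1)"
    if "finite W" "W \<subseteq> S" for W and k :: "'a \<Rightarrow> nat"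
    using that
  proof (induction W)
    case empty
    then show ?case using one by (simp add: single_one)
  next
    case (insert w W)
    let ?m = "\<Sum>v\<in>W. Poly_Mapping.single v (k v)"
    have "Poly_Mapping.keys ?m \<subseteq> S"
      using insert.hyps(1) insert.prems by (auto simp: keys_sum_nat split: if_splits)
    moreover have "Poly_Mapping.single (Poly_Mapping.single w (k w) + ?m) (1 :: int) =
        Poly_Mapping.single (Poly_Mapping.single w (k w)) 1 * Poly_Mapping.single ?m 1"
      by (simp add: mult_single)
    ultimately show ?case
      using insert power[of w "k w"] by (auto intro!: mult single split: if_splits)
  qed
  from this[of "Poly_Mapping.keys m" "Poly_Mapping.lookup m" for m]
  have monom: "P (Poly_Mapping.single m 1)" if "Poly_Mapping.keys m \<subseteq> S" for m
    using that by (simp flip: poly_mapping_eq_sum_single)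
  have monom_nat: "P (Poly_Mapping.single m (int n))" if "Poly_Mapping.keys m \<subseteq> S" for m n
  proof (induction n)
    case (Suc n)
    then show ?case using add[OF single single, OF that that monom[OF that] Suc]
      by (simp add: single_add[symmetric])
  qed (simp add: zero)
  have monom_scaled: "P (Poly_Mapping.single m c)" if m: "Poly_Mapping.keys m \<subseteq> S" for m c
  proof (cases c rule: int_cases2)
    case (nonneg n)
    then show ?thesis using monom_nat[OF m] by simp
  next
    case (nonpos n)
    then show ?thesis using uminus[OF single[OF m] monom_nat[OF m]] by (simp add: single_uminus)
  qed
  have "P (sum f A) " if "\<And>a. a \<in> A \<Longrightarrow> f a \<in> ?C" "\<And>a. a \<in> A \<Longrightarrow> P (f a)"
    for f :: "('a \<Rightarrow>\<^sub>0 nat) \<Rightarrow> 'a int_mpoly" and A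
    using that by (induction A rule: infinite_finite_induct)
      (auto simp: zero int_poly_carrier_sum intro!: add)
  from this[of "Poly_Mapping.keys p" "\<lambda>m. Poly_Mapping.single m (Poly_Mapping.lookup p m)"]
  show ?thesis using assms(1)
    by (auto simp: int_poly_carrier_iff monom_scaled simp flip: poly_mapping_eq_sum_single)
qed

text \<open>Induction along the generation of the ring by its variables; this is the source of the
  uniqueness of \<open>\<rho>\<close>.\<close>

lemma int_poly_ring_hom_eqI:
  assumes "ring T" "f \<in> ring_hom (int_poly_ring S) T" "g \<in> ring_hom (int_poly_ring S) T"
    and "\<And>v. v \<in> S \<Longrightarrow> f (var v) = g (var v)" and "p \<in> carrier (int_poly_ring S)"
  shows "f p = g p"
proof -
  interpret R: cring "int_poly_ring S" by (rule int_poly_ring_cring)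
  interpret T: ring T by fact
  interpret f: ring_hom_ring "int_poly_ring S" T f using assms(2) by unfold_locales
  interpret g: ring_hom_ring "int_poly_ring S" T g using assms(3) by unfold_locales
  have neg: "\<ominus>\<^bsub>int_poly_ring S\<^esub> p = - p" if "p \<in> carrier (int_poly_ring S)" for p
    using that by (intro R.minus_equality) (auto simp: int_poly_ring_ops int_poly_carrier)
  show ?thesis using assms(5)
  proof (induction rule: int_poly_ring_induct)
    case one
    then show ?case using f.hom_one g.hom_one by (simp add: int_poly_ring_ops)
  next
    case (uminus p)
    then show ?case using f.hom_a_inv[of p] g.hom_a_inv[of p] by (simp add: neg)
  next
    case (add p q)
    then show ?case using f.hom_add[of p q] g.hom_add[of p q] by (simp add: int_poly_ring_ops)
  next
    case (mult p q)
    then show ?case using f.hom_mult[of p q] g.hom_mult[of p q] by (simp add: int_poly_ring_ops)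
  qed (use assms(4) in auto)
qed

section \<open>The relations of a finite preorder and evaluation at upper sets\<close>

locale finite_preorder_on =
  fixes S :: "'v set" and le :: "'v \<Rightarrow> 'v \<Rightarrow> bool"
  assumes finite_S: "finite S"
    and le_refl: "\<And>x. le x x" and le_trans: "\<And>x y z. le x y \<Longrightarrow> le y z \<Longrightarrow> le x z"
begin

definition upper :: "'v set \<Rightarrow> bool" where
  "upper I \<longleftrightarrow> I \<subseteq> S \<and> (\<forall>\<alpha>\<in>I. \<forall>\<beta>\<in>S. le \<alpha> \<beta> \<longrightarrow> \<beta> \<in> I)"

definition rels :: "'v int_mpoly set" where
  "rels = {var \<alpha> * var \<beta> - var \<alpha> | \<alpha> \<beta>. \<alpha> \<in> S \<and> \<beta> \<in> S \<and> le \<alpha> \<beta>}"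

definition J :: "'v int_mpoly set" where
  "J = Idl\<^bsub>int_poly_ring S\<^esub> rels"

definition up :: "('v \<Rightarrow>\<^sub>0 nat) \<Rightarrow> 'v set" where
  "up m = {\<beta> \<in> S. \<exists>\<alpha>\<in>Poly_Mapping.keys m. le \<alpha> \<beta>}"

abbreviation mon :: "('v \<Rightarrow>\<^sub>0 nat) \<Rightarrow> 'v int_mpoly" where
  "mon m \<equiv> Poly_Mapping.single m 1"

lemma rels_carrier: "rels \<subseteq> carrier (int_poly_ring S)"
  by (auto simp: rels_def intro!: int_poly_carrier)

lemma ideal_J: "ideal J (int_poly_ring S)"
proof -
  interpret cring "int_poly_ring S" by (rule int_poly_ring_cring)
  show ?thesis unfolding J_def using rels_carrier by (rule genideal_ideal)
qed

lemma J_rel: "\<alpha> \<in> S \<Longrightarrow> \<beta> \<in> S \<Longrightarrow> le \<alpha> \<beta> \<Longrightarrow> var \<alpha> * var \<beta> - var \<alpha> \<in> J"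
proof -
  interpret cring "int_poly_ring S" by (rule int_poly_ring_cring)
  show "\<alpha> \<in> S \<Longrightarrow> \<beta> \<in> S \<Longrightarrow> le \<alpha> \<beta> \<Longrightarrow> var \<alpha> * var \<beta> - var \<alpha> \<in> J"
    using genideal_self[OF rels_carrier] unfolding J_def by (auto simp: rels_def)
qed

lemma
  shows J_0: "0 \<in> J" and J_add: "a \<in> J \<Longrightarrow> b \<in> J \<Longrightarrow> a + b \<in> J"
    and J_mult: "a \<in> J \<Longrightarrow> c \<in> carrier (int_poly_ring S) \<Longrightarrow> c * a \<in> J"
proof -
  interpret ideal J "int_poly_ring S" by (rule ideal_J)
  show "0 \<in> J" using additive_subgroup.zero_closed[OF additive_subgroup_axioms] by (simp add: int_poly_ring_ops)
  show "a \<in> J \<Longrightarrow> b \<in> J \<Longrightarrow> a + b \<in> J" using additive_subgroup.a_closed[OF additive_subgroup_axioms, of a b] by (simp add: int_poly_ring_ops)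
  show "a \<in> J \<Longrightarrow> c \<in> carrier (int_poly_ring S) \<Longrightarrow> c * a \<in> J"
    using I_l_closed[of a c] by (simp add: int_poly_ring_ops)
qed

lemma J_uminus: "a \<in> J \<Longrightarrow> - a \<in> J"
  using J_mult[of a "-1"] by (simp add: int_poly_carrier)

lemma J_cong_trans: "a - b \<in> J \<Longrightarrow> b - c \<in> J \<Longrightarrow> a - c \<in> J"
  using J_add[of "a - b" "b - c"] by simp

lemma J_sum: "(\<And>a. a \<in> A \<Longrightarrow> f a \<in> J) \<Longrightarrow> sum f A \<in> J"
  by (induction A rule: infinite_finite_induct) (auto simp: J_0 J_add)

text \<open>Some variable \<open>v\<close> of \<open>m\<close> satisfies \<open>le v w\<close>.
  Splitting off one factor \<open>v\<close> exhibits the difference as a monomial times a defining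
  relation.\<close>

lemma absorb_var:
  assumes "Poly_Mapping.keys m \<subseteq> S" "w \<in> up m"
  shows "mon (m + Poly_Mapping.single w 1) - mon m \<in> J"
proof -
  obtain v where v: "v \<in> Poly_Mapping.keys m" "le v w" and w: "w \<in> S"
    using assms(2) by (auto simp: up_def)
  define m' where "m' = m - Poly_Mapping.single v 1"
  have m: "m = m' + Poly_Mapping.single v 1"
    using v(1) by (intro poly_mapping_eqI)
      (auto simp: m'_def lookup_add lookup_minus lookup_single when_def in_keys_iff)
  have "mon (m + Poly_Mapping.single w 1) - mon m = mon m' * (var v * var w - var v)"
    unfolding m by (simp add: var_def mult_single algebra_simps)
  moreover have "Poly_Mapping.keys m' \<subseteq> S" using assms(1) by (subst (asm) m) (simp add: keys_add_nat)
  ultimately show ?thesis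
    using v w assms(1) by (auto intro!: J_mult J_rel single_in_int_poly_carrier)
qed

text \<open>The factors of \<open>n\<close> are absorbed one at a time, first the powers of a single
  variable and then variable by variable. The set \<open>up m\<close> only grows as factors are
  added, so absorption stays possible.\<close>

lemma absorb_monomial:
  assumes "Poly_Mapping.keys m \<subseteq> S" "Poly_Mapping.keys n \<subseteq> up m"
  shows "mon (m + n) - mon m \<in> J"
proof -
  have power: "mon (m + Poly_Mapping.single w k) - mon m \<in> J"
    if "Poly_Mapping.keys m \<subseteq> S" "w \<in> up m" for m w k
  proof (induction k)
    case (Suc k)
    have "mon (m + Poly_Mapping.single w k + Poly_Mapping.single w 1) - mon (m + Poly_Mapping.single w k) \<in> J"
      using that by (intro absorb_var) (auto simp: keys_add_nat up_def)
    from J_cong_trans[OF this Suc] show ?case by (simp add: add.assoc single_add[symmetric])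
  qed (simp add: J_0)
  have "mon (m + (\<Sum>w\<in>W. Poly_Mapping.single w (c w))) - mon m \<in> J"
    if "finite W" "W \<subseteq> up m" for W c
    using that
  proof (induction W)
    case (insert w W)
    let ?n = "\<Sum>w\<in>W. Poly_Mapping.single w (c w)"
    have "Poly_Mapping.keys ?n \<subseteq> S"
      using insert.hyps(1) insert.prems by (auto simp: keys_sum_nat up_def split: if_splits)
    then have "mon (m + ?n + Poly_Mapping.single w (c w)) - mon (m + ?n) \<in> J"
      using assms(1) insert.prems by (intro power) (auto simp: keys_add_nat up_def)
    moreover have "mon (m + ?n) - mon m \<in> J" using insert by simp
    ultimately show ?case using insert.hyps J_cong_trans by (fastforce simp: ac_simps)
  qed (simp add: J_0)
  from this[of "Poly_Mapping.keys n" "Poly_Mapping.lookup n"] show ?thesis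
    using assms(2) by (simp flip: poly_mapping_eq_sum_single)
qed

lemma keys_subset_up: "Poly_Mapping.keys m \<subseteq> S \<Longrightarrow> Poly_Mapping.keys m \<subseteq> up m"
  using le_refl by (auto simp: up_def)

lemma upper_up: "upper (up m)"
  unfolding upper_def up_def using le_trans by blast

text \<open>An upper set containing the variables of \<open>m\<close> contains everything above
  them. This turns survival of \<open>m\<close> under evaluation at \<open>I\<close> into a
  condition on \<open>up m\<close>.\<close>

lemma up_subset_iff: "Poly_Mapping.keys m \<subseteq> S \<Longrightarrow> upper I \<Longrightarrow> up m \<subseteq> I \<longleftrightarrow> Poly_Mapping.keys m \<subseteq> I"
  using keys_subset_up[of m] unfolding upper_def up_def by blast

text \<open>Each of the two monomials absorbs the other, so both are congruent to their
  product.\<close>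

lemma mon_cong:
  assumes "Poly_Mapping.keys m \<subseteq> S" "Poly_Mapping.keys n \<subseteq> S" "up m = up n"
  shows "mon m - mon n \<in> J"
proof -
  have "mon (m + n) - mon m \<in> J" "mon (n + m) - mon n \<in> J"
    using assms keys_subset_up[of m] keys_subset_up[of n] by (auto intro!: absorb_monomial)
  then have "- (mon (m + n) - mon m) + (mon (m + n) - mon n) \<in> J"
    by (intro J_add J_uminus) (simp_all add: add.commute)
  then show ?thesis by simp
qed

text \<open>
  Modulo \<open>J\<close> a monomial \<open>m\<close> only depends on the upper set \<open>up m\<close>. Collecting coefficients, the
  vanishing of all evaluations is a triangular system for the collected coefficients.
\<close>
lemma mem_J_if_eval_at_eq_0:
  assumes p: "p \<in> carrier (int_poly_ring S)" and ev: "\<And>I. upper I \<Longrightarrow> eval_at I p = 0"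
  shows "p \<in> J"
proof -
  let ?K = "Poly_Mapping.keys p"
  define d where "d I = (\<Sum>m\<in>{m \<in> ?K. up m = I}. Poly_Mapping.lookup p m)" for I
  have keys: "Poly_Mapping.keys m \<subseteq> S" if "m \<in> ?K" for m
    using p that by (simp add: int_poly_carrier_iff)
  have d0: "d I = 0" if "upper I" for I
  proof -
    have "finite I" using that finite_S by (auto simp: upper_def intro: finite_subset)
    then show ?thesis using that
    proof (induction I rule: finite_psubset_induct)
      case (psubset I)
      let ?L = "{m \<in> ?K. up m \<subset> I}"
      \<comment> \<open>The value at \<open>I\<close> collects the monomials with
        \<open>up m\<close> inside \<open>I\<close>. Grouped by \<open>up m\<close>, those from
        proper subsets cancel by induction and leave the diagonal term \<open>d I\<close>.\<close>
      have "0 = (\<Sum>m\<in>{m \<in> ?K. Poly_Mapping.keys m \<subseteq> I}. Poly_Mapping.lookup p m)"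
        using ev[OF psubset.prems] by (simp add: eval_at_def sum.inter_filter)
      also have "{m \<in> ?K. Poly_Mapping.keys m \<subseteq> I} = {m \<in> ?K. up m = I} \<union> ?L"
        using up_subset_iff[OF keys psubset.prems] by auto
      also have "(\<Sum>m\<in>\<dots>. Poly_Mapping.lookup p m) = d I + (\<Sum>m\<in>?L. Poly_Mapping.lookup p m)"
        unfolding d_def by (rule sum.union_disjoint) auto
      also have "(\<Sum>m\<in>?L. Poly_Mapping.lookup p m) =
          (\<Sum>I'\<in>up ` ?L. \<Sum>m\<in>{m \<in> ?L. up m = I'}. Poly_Mapping.lookup p m)"
        by (rule sum.image_gen) simp
      also have "\<dots> = (\<Sum>I'\<in>up ` ?L. d I')"
        unfolding d_def by (intro sum.cong) auto
      also have "\<dots> = 0"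
        using psubset.IH upper_up by (intro sum.neutral) auto
      finally show ?case by simp
    qed
  qed
  define r where "r I = (SOME m. m \<in> ?K \<and> up m = I)" for I
  have r: "r (up m) \<in> ?K" "up (r (up m)) = up m" if "m \<in> ?K" for m
    using someI[of "\<lambda>n. n \<in> ?K \<and> up n = up m" m] that by (auto simp: r_def)
  let ?c = "Poly_Mapping.lookup p"
  \<comment> \<open>Replacing every monomial by its representative collects the coefficients into
    the numbers \<open>d I\<close>, all zero. Hence \<open>p\<close> equals the difference made by
    the replacement, which lies in \<open>J\<close> term by term.\<close>
  have "(\<Sum>m\<in>?K. Poly_Mapping.single (r (up m)) (?c m)) =
      (\<Sum>I\<in>up ` ?K. \<Sum>m\<in>{m \<in> ?K. up m = I}. Poly_Mapping.single (r (up m)) (?c m))"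
    by (rule sum.image_gen) simp
  also have "\<dots> = (\<Sum>I\<in>up ` ?K. Poly_Mapping.single (r I) (d I))"
    unfolding d_def single_sum by (intro sum.cong) auto
  also have "\<dots> = 0" using d0 upper_up by (intro sum.neutral) auto
  finally have "p = (\<Sum>m\<in>?K. Poly_Mapping.single m (?c m)) -
      (\<Sum>m\<in>?K. Poly_Mapping.single (r (up m)) (?c m))"
    by (simp flip: poly_mapping_eq_sum_single)
  also have "\<dots> = (\<Sum>m\<in>?K. Poly_Mapping.single 0 (?c m) * (mon m - mon (r (up m))))"
    by (simp add: sum_subtractf[symmetric] right_diff_distrib mult_single)
  also have "\<dots> \<in> J"
    using keys r by (intro J_sum J_mult mon_cong single_in_int_poly_carrier) auto
  finally show ?thesis .
qed

text \<open>For \<open>\<alpha>\<close> in \<open>I\<close>, upward closure puts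
  \<open>\<beta>\<close> in \<open>I\<close> and both terms are 1; for \<open>\<alpha>\<close>
  outside \<open>I\<close> both are 0.\<close>

lemma eval_at_rels: "upper I \<Longrightarrow> q \<in> rels \<Longrightarrow> eval_at I q = 0"
  by (auto simp: rels_def upper_def eval_at_diff eval_at_mult eval_at_var)

text \<open>The interpolation polynomial of a vertex of the cube of zero-one vectors; it has integer
  coefficients, as surjectivity over the integers demands.\<close>

definition indicator_poly :: "'v set \<Rightarrow> 'v int_mpoly" where
  "indicator_poly I = (\<Prod>\<alpha>\<in>I. var \<alpha>) * (\<Prod>\<alpha>\<in>S - I. 1 - var \<alpha>)"

lemma indicator_poly_carrier: "I \<subseteq> S \<Longrightarrow> indicator_poly I \<in> carrier (int_poly_ring S)"
  unfolding indicator_poly_def by (intro int_poly_carrier int_poly_carrier_prod) auto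

lemma eval_at_indicator_poly:
  assumes "I \<subseteq> S" "K \<subseteq> S"
  shows "eval_at K (indicator_poly I) = (if K = I then 1 else 0)"
proof -
  have fin: "finite I" "finite (S - I)" using assms finite_S by (auto intro: finite_subset)
  have "eval_at K (indicator_poly I) =
      (\<Prod>\<alpha>\<in>I. if \<alpha> \<in> K then 1 else 0) * (\<Prod>\<alpha>\<in>S - I. 1 - (if \<alpha> \<in> K then 1 else 0))"
    by (simp add: indicator_poly_def eval_at_mult eval_at_prod eval_at_diff eval_at_1 eval_at_var)
  also have "\<dots> = (if K = I then 1 else 0)"
  proof (cases "K = I")
    case False
    then obtain \<alpha> where "\<alpha> \<in> I - K \<or> \<alpha> \<in> (S - I) \<inter> K" using assms by blast
    then show ?thesis using False fin by (auto intro!: prod_zero bexI[of _ \<alpha>])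
  qed simp
  finally show ?thesis .
qed

end

text \<open>A ring morphism commutes with integer spans and with finite products, and the filtration
  is built from 1 and the generators by these operations.\<close>

lemma filtration_image:
  assumes "cring R" "cring S" "\<rho> \<in> ring_hom R S" "G \<subseteq> carrier R"
  shows "\<rho> ` filtration R G k = filtration S (\<rho> ` G) k"
proof -
  interpret ring_hom_cring R S \<rho> using assms by (simp add: ring_hom_cring_axioms_def ring_hom_cring_def)
  have span: "\<rho> ` int_span R K = int_span S (\<rho> ` K)" if "K \<subseteq> carrier R" for K
  proof -
    interpret a: group_hom "add_monoid R" "add_monoid S" \<rho>
      by (rule ring.a_group_hom)
    show ?thesis unfolding int_span_def using a.generate_img[of K] that by simp
  qed
  have F1_sub: "F1 R G \<subseteq> carrier R"
  proof -
    have "insert \<one>\<^bsub>R\<^esub> G \<subseteq> carrier R" using assms(4) by simp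
    from R.add.generate_incl[OF this] show ?thesis by (simp add: F1_def int_span_def)
  qed
  have F1: "\<rho> ` F1 R G = F1 S (\<rho> ` G)"
    unfolding F1_def using assms(4) by (subst span) auto
  have prods: "\<rho> ` {finprod R f {..<k} | f. f \<in> {..<k} \<rightarrow> F1 R G} =
      {finprod S f {..<k} | f. f \<in> {..<k} \<rightarrow> F1 S (\<rho> ` G)}"
  proof (intro equalityI subsetI)
    fix y assume "y \<in> \<rho> ` {finprod R f {..<k} | f. f \<in> {..<k} \<rightarrow> F1 R G}"
    then obtain f where f: "f \<in> {..<k} \<rightarrow> F1 R G" "y = \<rho> (finprod R f {..<k})" by blast
    then have "y = finprod S (\<rho> \<circ> f) {..<k}" using F1_sub by (subst f(2), intro hom_finprod) auto
    moreover have "\<rho> \<circ> f \<in> {..<k} \<rightarrow> F1 S (\<rho> ` G)" using f(1) unfolding F1[symmetric] by auto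
    ultimately show "y \<in> {finprod S f {..<k} | f. f \<in> {..<k} \<rightarrow> F1 S (\<rho> ` G)}" by blast
  next
    fix y assume "y \<in> {finprod S f {..<k} | f. f \<in> {..<k} \<rightarrow> F1 S (\<rho> ` G)}"
    then obtain g where g: "g \<in> {..<k} \<rightarrow> F1 S (\<rho> ` G)" "y = finprod S g {..<k}" by blast
    have "g i \<in> \<rho> ` F1 R G" if "i < k" for i using g(1) that unfolding F1 by auto
    then have "\<forall>i\<in>{..<k}. \<exists>x. x \<in> F1 R G \<and> \<rho> x = g i" by fastforce
    \<comment> \<open>Preimages of the factors are chosen separately for each index, so that their
      product maps to \<open>y\<close>.\<close>
    then obtain f where f: "\<And>i. i < k \<Longrightarrow> f i \<in> F1 R G \<and> \<rho> (f i) = g i"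
      by (metis lessThan_iff)
    have "finprod S (\<rho> \<circ> f) {..<k} = finprod S g {..<k}"
    proof (rule S.finprod_cong')
      have "\<rho> (f i) \<in> carrier S" if "i < k" for i using f[OF that] F1_sub by blast
      then show "g \<in> {..<k} \<rightarrow> carrier S" using f by auto
    qed (use f in auto)
    then have "y = \<rho> (finprod R f {..<k})" using f F1_sub g(2) by (subst hom_finprod) auto
    then show "y \<in> \<rho> ` {finprod R f {..<k} | f. f \<in> {..<k} \<rightarrow> F1 R G}" using f by blast
  qed
  have "{finprod R f {..<k} | f. f \<in> {..<k} \<rightarrow> F1 R G} \<subseteq> carrier R"
    using F1_sub by (auto intro!: R.finprod_closed)
  then show ?thesis
    using span prods F1 by (auto simp: filtration_def)
qed

section \<open>The isomorphism\<close>

lemma locally_constant_ring_ops: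
  "mult (locally_constant_ring S) = (\<lambda>f g. \<lambda>x\<in>S. f x * g x)"
  "one (locally_constant_ring S) = (\<lambda>x\<in>S. 1)"
  "zero (locally_constant_ring S) = (\<lambda>x\<in>S. 0)"
  "add (locally_constant_ring S) = (\<lambda>f g. \<lambda>x\<in>S. f x + g x)"
  by (simp_all add: locally_constant_ring_def)

lemma locally_constant_constant_on:
  assumes "locally_constant_on S f" "T \<subseteq> S" "connected T"
  shows "f constant_on T"
proof (rule locally_constant_imp_constant[OF assms(3)])
  fix a assume "a \<in> T"
  then obtain V where V: "openin (top_of_set S) V" "a \<in> V" "f constant_on V"
    using assms(1,2) unfolding locally_constant_on_def by blast
  then have "openin (top_of_set T) (T \<inter> V)"
    using assms(2) by (metis inf_commute openin_subset_trans openin_Int openin_subtopology_self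
      openin_subtopology_Int2 inf.absorb_iff2 subtopology_subtopology)
  moreover have "\<forall>x\<in>T \<inter> V. f x = f a" using V by (auto simp: constant_on_def)
  ultimately show "\<exists>U. openin (top_of_set T) U \<and> a \<in> U \<and> (\<forall>x\<in>U. f x = f a)"
    using \<open>a \<in> T\<close> V(2) by blast
qed

section \<open>Evaluation of polynomials on the Shi regions\<close>

context simple_root_system begin

sublocale finite_preorder_on pos "root_le \<Delta>"
  using finite_pos root_le_refl root_le_trans by unfold_locales

abbreviation shi_dom :: "'a set" where "shi_dom \<equiv> shi_domain \<Phi> \<Delta>"

definition above :: "'a \<Rightarrow> 'a set" where
  "above x = {\<alpha> \<in> pos. \<alpha> \<bullet> x > 1}"

text \<open>Substitution of the functions \<open>h_fun\<close> for the variables: at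
  \<open>x\<close> they take the values 0 and 1, with support \<open>above x\<close>. It becomes
  \<open>\<rho>\<close> after passing to the quotient.\<close>

definition eval_map :: "'a int_mpoly \<Rightarrow> 'a \<Rightarrow> int" where
  "eval_map p = (\<lambda>x\<in>shi_dom. eval_at (above x) p)"

lemma U_ideal_eq: "U_ideal \<Phi> \<Delta> = J"
  by (simp add: U_ideal_def J_def rels_def)

lemma mem_shi_domain: "x \<in> shi_dom \<longleftrightarrow> (\<forall>\<alpha>\<in>pos. \<alpha> \<bullet> x > 0 \<and> \<alpha> \<bullet> x \<noteq> 1)"
  by (auto simp: shi_domain_def dominant_chamber_def shi_arrangement_def)

lemma simple_pos: "\<Delta> \<subseteq> pos"
proof
  fix \<delta> assume \<delta>: "\<delta> \<in> \<Delta>"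
  then have "\<delta> = (\<Sum>\<gamma>\<in>\<Delta>. (if \<gamma> = \<delta> then 1 else 0) *\<^sub>R \<gamma>)"
    using finite_simple by (simp add: if_distrib[of "\<lambda>c. c *\<^sub>R _"] cong: if_cong)
  then have "root_le \<Delta> 0 \<delta>" unfolding root_le_def
    by (intro exI[of _ "\<lambda>\<gamma>. if \<gamma> = \<delta> then 1 else 0"]) simp
  then show "\<delta> \<in> pos" using \<delta> simple_subset by (auto simp: positive_roots_def)
qed

text \<open>Simple roots are positive roots, hence positive on the dominant chamber, and
  \<open>\<beta> - \<alpha>\<close> is a nonnegative combination of them.\<close>

lemma root_le_inner_mono:
  assumes "root_le \<Delta> \<alpha> \<beta>" "x \<in> shi_dom"
  shows "\<alpha> \<bullet> x \<le> \<beta> \<bullet> x"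
proof -
  obtain c :: "'a \<Rightarrow> real" where c: "\<forall>\<delta>\<in>\<Delta>. c \<delta> \<ge> 0" "\<beta> - \<alpha> = (\<Sum>\<delta>\<in>\<Delta>. c \<delta> *\<^sub>R \<delta>)"
    using assms(1) by (auto simp: root_le_def)
  have "\<beta> \<bullet> x - \<alpha> \<bullet> x = (\<Sum>\<delta>\<in>\<Delta>. c \<delta> * (\<delta> \<bullet> x))"
    by (simp add: inner_diff_left[symmetric] c(2) inner_sum_left)
  also have "\<dots> \<ge> 0"
    using c(1) assms(2) simple_pos
    by (intro sum_nonneg mult_nonneg_nonneg) (auto simp: mem_shi_domain intro: less_imp_le)
  finally show ?thesis by simp
qed

lemma upper_above:
  assumes "x \<in> shi_dom"
  shows "upper (above x)"
  unfolding upper_def above_def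
proof (intro conjI ballI impI)
  fix \<alpha> \<beta> assume "\<alpha> \<in> {\<alpha> \<in> pos. 1 < \<alpha> \<bullet> x}" "\<beta> \<in> pos" "root_le \<Delta> \<alpha> \<beta>"
  then show "\<beta> \<in> {\<alpha> \<in> pos. 1 < \<alpha> \<bullet> x}"
    using root_le_inner_mono[OF _ assms, of \<alpha> \<beta>] by simp
qed simp

lemma ex_above_eq:
  assumes "upper I"
  shows "\<exists>x\<in>shi_dom. above x = I"
proof -
  have "I \<subseteq> pos" "\<And>\<alpha> \<beta>. \<alpha> \<in> I \<Longrightarrow> \<beta> \<in> pos \<Longrightarrow> root_le \<Delta> \<alpha> \<beta> \<Longrightarrow> \<beta> \<in> I"
    using assms by (auto simp: upper_def)
  then obtain x where x: "\<And>\<alpha>. \<alpha> \<in> pos \<Longrightarrow> \<alpha> \<bullet> x > 0" "\<And>\<alpha>. \<alpha> \<in> I \<Longrightarrow> \<alpha> \<bullet> x > 1"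
    "\<And>\<alpha>. \<alpha> \<in> pos - I \<Longrightarrow> \<alpha> \<bullet> x < 1"
    using shi_region_nonempty by metis
  have "\<alpha> \<bullet> x \<noteq> 1" if "\<alpha> \<in> pos" for \<alpha> using x(2)[of \<alpha>] x(3)[of \<alpha>] that by (cases "\<alpha> \<in> I") auto
  then have "x \<in> shi_dom" using x(1) by (auto simp: mem_shi_domain)
  moreover have "above x = I" using x(2,3) \<open>I \<subseteq> pos\<close> unfolding above_def by force
  ultimately show ?thesis by blast
qed

text \<open>Writing a region by finitely many strict linear inequalities makes it visibly open and
  convex.\<close>

lemma region_eq:
  assumes "I \<subseteq> pos"
  shows "{x \<in> shi_dom. above x = I} =
    (\<Inter>\<alpha>\<in>pos. {x. \<alpha> \<bullet> x > 0}) \<inter> (\<Inter>\<alpha>\<in>I. {x. \<alpha> \<bullet> x > 1}) \<inter> (\<Inter>\<alpha>\<in>pos - I. {x. \<alpha> \<bullet> x < 1})"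
  (is "?L = ?R")
proof (intro equalityI subsetI)
  fix x assume "x \<in> ?L"
  then show "x \<in> ?R" by (force simp: mem_shi_domain above_def)
next
  fix x assume x: "x \<in> ?R"
  then have "\<alpha> \<in> I \<Longrightarrow> \<alpha> \<bullet> x > 1" "\<alpha> \<in> pos - I \<Longrightarrow> \<alpha> \<bullet> x < 1" for \<alpha> by auto
  then have "\<alpha> \<bullet> x \<noteq> 1" if "\<alpha> \<in> pos" for \<alpha> using that by (cases "\<alpha> \<in> I") force+
  moreover have "above x = I" using x assms unfolding above_def by force
  ultimately show "x \<in> ?L" using x by (auto simp: mem_shi_domain)
qed

lemma open_region: "I \<subseteq> pos \<Longrightarrow> open {x \<in> shi_dom. above x = I}"
  unfolding region_eq using finite_pos
  by (intro open_Int open_INT ballI) (auto simp: open_halfspace_gt open_halfspace_lt intro: finite_subset)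

lemma connected_region: "I \<subseteq> pos \<Longrightarrow> connected {x \<in> shi_dom. above x = I}"
  unfolding region_eq
  by (intro convex_connected convex_Int convex_INT)
    (auto simp: convex_halfspace_gt convex_halfspace_lt)

lemma above_subset: "above x \<subseteq> pos"
  by (auto simp: above_def)

lemma eval_map_closed: "eval_map p \<in> carrier (H_ring \<Phi> \<Delta>)"
proof -
  have "\<exists>T. openin (top_of_set shi_dom) T \<and> x \<in> T \<and> eval_map p constant_on T" if x: "x \<in> shi_dom" for x
  proof (intro exI conjI)
    show "openin (top_of_set shi_dom) {y \<in> shi_dom. above y = above x}"
      using open_region[OF above_subset] by (intro open_subset) auto
    show "eval_map p constant_on {y \<in> shi_dom. above y = above x}"
      by (auto simp: constant_on_def eval_map_def)
  qed (use x in auto)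
  then show ?thesis
    by (simp add: H_ring_def locally_constant_ring_def locally_constant_on_def eval_map_def)
qed

lemma eval_map_var: "\<alpha> \<in> pos \<Longrightarrow> eval_map (var \<alpha>) = h_fun \<Phi> \<Delta> \<alpha>"
  unfolding eval_map_def h_fun_def by (intro restrict_ext) (simp add: eval_at_var above_def)

lemma eval_map_hom: "eval_map \<in> ring_hom (int_poly_ring pos) (H_ring \<Phi> \<Delta>)"
  by (rule ring_hom_memI[OF eval_map_closed])
    (auto simp: int_poly_ring_ops H_ring_def locally_constant_ring_ops eval_map_def
      eval_at_add eval_at_mult eval_at_1 intro!: restrict_ext)

text \<open>Regions are connected, so a locally constant function depends only on
  \<open>above x\<close> and can be interpolated by the indicator polynomials.\<close>

lemma eval_map_surj: "eval_map ` carrier (int_poly_ring pos) = carrier (H_ring \<Phi> \<Delta>)"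
proof
  show "eval_map ` carrier (int_poly_ring pos) \<subseteq> carrier (H_ring \<Phi> \<Delta>)"
    using eval_map_closed by blast
  show "carrier (H_ring \<Phi> \<Delta>) \<subseteq> eval_map ` carrier (int_poly_ring pos)"
  proof
    fix f assume "f \<in> carrier (H_ring \<Phi> \<Delta>)"
    then have f: "f \<in> extensional shi_dom" "locally_constant_on shi_dom f"
      by (auto simp: H_ring_def locally_constant_ring_def)
    have const: "f constant_on {x \<in> shi_dom. above x = I}" if "I \<subseteq> pos" for I
      using locally_constant_constant_on[OF f(2) _ connected_region[OF that]] by auto
    then obtain c where c: "\<And>I x. I \<subseteq> pos \<Longrightarrow> x \<in> shi_dom \<Longrightarrow> above x = I \<Longrightarrow> f x = c I"
      unfolding constant_on_def by (metis (mono_tags, lifting) mem_Collect_eq)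
    \<comment> \<open>The sum ranges over all subsets of \<open>pos\<close>. Where a region is
      empty, \<open>c I\<close> is an arbitrary integer whose term vanishes at every point.\<close>
    define p where "p = (\<Sum>I\<in>Pow pos. Poly_Mapping.single 0 (c I) * indicator_poly I)"
    have "eval_map p = f"
    proof (rule extensionalityI)
      show "eval_map p \<in> extensional shi_dom" by (simp add: eval_map_def)
      fix x assume x: "x \<in> shi_dom"
      have "eval_map p x = (\<Sum>I\<in>Pow pos. c I * (if above x = I then 1 else 0))"
        using x above_subset
        by (simp add: eval_map_def p_def eval_at_sum eval_at_mult eval_at_single eval_at_indicator_poly)
      also have "\<dots> = (\<Sum>I\<in>Pow pos. if above x = I then c I else 0)"
        by (intro sum.cong) auto
      also have "\<dots> = c (above x)" using finite_pos above_subset by (simp add: sum.delta')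
      also have "\<dots> = f x" using c[OF above_subset x] by simp
      finally show "eval_map p x = f x" .
    qed (rule f(1))
    moreover have "p \<in> carrier (int_poly_ring pos)"
      unfolding p_def
      by (intro int_poly_carrier_sum int_poly_carrier indicator_poly_carrier single_in_int_poly_carrier) auto
    ultimately show "f \<in> eval_map ` carrier (int_poly_ring pos)" by blast
  qed
qed

lemma eval_map_hom_ring: "ring_hom_ring (int_poly_ring pos) (H_ring \<Phi> \<Delta>) eval_map"
  using eval_map_hom int_poly_ring_cring locally_constant_ring_cring
  by (intro ring_hom_ringI2) (auto simp: H_ring_def intro: cring.axioms)

lemma mem_eval_map_kernel_iff:
  "p \<in> a_kernel (int_poly_ring pos) (H_ring \<Phi> \<Delta>) eval_map \<longleftrightarrow>
    p \<in> carrier (int_poly_ring pos) \<and> (\<forall>x\<in>shi_dom. eval_at (above x) p = 0)"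
proof -
  have "eval_map p = \<zero>\<^bsub>H_ring \<Phi> \<Delta>\<^esub> \<longleftrightarrow> (\<forall>x\<in>shi_dom. eval_at (above x) p = 0)"
    unfolding H_ring_def locally_constant_ring_ops eval_map_def
    by (metis (mono_tags, lifting) restrict_apply' restrict_ext)
  then show ?thesis by (simp only: a_kernel_def' mem_Collect_eq)
qed

text \<open>Every upper set is \<open>above x\<close> for some \<open>x\<close>, so a polynomial in
  the kernel vanishes at all upper sets and lies in the ideal. Conversely, each
  \<open>above x\<close> is upper, so the relations evaluate to 0.\<close>

lemma eval_map_kernel: "a_kernel (int_poly_ring pos) (H_ring \<Phi> \<Delta>) eval_map = U_ideal \<Phi> \<Delta>"
proof
  interpret ring_hom_ring "int_poly_ring pos" "H_ring \<Phi> \<Delta>" eval_map by (rule eval_map_hom_ring)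
  show "a_kernel (int_poly_ring pos) (H_ring \<Phi> \<Delta>) eval_map \<subseteq> U_ideal \<Phi> \<Delta>"
  proof
    fix p assume "p \<in> a_kernel (int_poly_ring pos) (H_ring \<Phi> \<Delta>) eval_map"
    then have p: "p \<in> carrier (int_poly_ring pos)" and ev: "\<forall>x\<in>shi_dom. eval_at (above x) p = 0"
      unfolding mem_eval_map_kernel_iff by (rule conjunct1, rule conjunct2)
    have "eval_at I p = 0" if I: "upper I" for I
    proof -
      obtain x where x: "x \<in> shi_dom" "above x = I" using ex_above_eq[OF I] by blast
      show ?thesis using bspec[OF ev x(1)] by (simp only: x(2))
    qed
    from mem_J_if_eval_at_eq_0[OF p this] show "p \<in> U_ideal \<Phi> \<Delta>" by (simp add: U_ideal_eq)
  qed
  have "rels \<subseteq> a_kernel (int_poly_ring pos) (H_ring \<Phi> \<Delta>) eval_map"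
    using rels_carrier eval_at_rels upper_above
    by (intro subsetI, unfold mem_eval_map_kernel_iff) blast
  then show "U_ideal \<Phi> \<Delta> \<subseteq> a_kernel (int_poly_ring pos) (H_ring \<Phi> \<Delta>) eval_map"
    unfolding U_ideal_eq J_def by (intro R.genideal_minimal kernel_is_ideal)
qed

section \<open>The quotient ring and its morphism to locally constant functions\<close>

lemma cring_U: "cring (U_ring \<Phi> \<Delta>)"
  unfolding U_ring_def U_ideal_eq by (rule ideal.quotient_is_cring[OF ideal_J int_poly_ring_cring])

lemma cring_H: "cring (H_ring \<Phi> \<Delta>)"
  by (simp add: H_ring_def locally_constant_ring_cring)

lemma u_gen_closed: "u_gen \<Phi> \<Delta> ` pos \<subseteq> carrier (U_ring \<Phi> \<Delta>)"
  unfolding u_gen_def U_ring_def U_ideal_eq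
  by (intro image_subsetI ring_hom_closed[OF ideal.rcos_ring_hom[OF ideal_J]] int_poly_carrier)

text \<open>Every class is the image of a polynomial, so both maps can be composed with the quotient
  map and compared on the variables.\<close>

lemma U_ring_hom_eqI:
  assumes "f \<in> ring_hom (U_ring \<Phi> \<Delta>) (H_ring \<Phi> \<Delta>)" "g \<in> ring_hom (U_ring \<Phi> \<Delta>) (H_ring \<Phi> \<Delta>)"
    and "\<And>\<alpha>. \<alpha> \<in> pos \<Longrightarrow> f (u_gen \<Phi> \<Delta> \<alpha>) = g (u_gen \<Phi> \<Delta> \<alpha>)" and "X \<in> carrier (U_ring \<Phi> \<Delta>)"
  shows "f X = g X"
proof -
  let ?q = "(+>\<^bsub>int_poly_ring pos\<^esub>) (U_ideal \<Phi> \<Delta>)"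
  have q: "?q \<in> ring_hom (int_poly_ring pos) (U_ring \<Phi> \<Delta>)"
    unfolding U_ring_def U_ideal_eq by (rule ideal.rcos_ring_hom[OF ideal_J])
  obtain p where p: "p \<in> carrier (int_poly_ring pos)" "X = ?q p"
    using assms(4) by (auto simp: U_ring_def FactRing_def A_RCOSETS_def')
  have "(f \<circ> ?q) p = (g \<circ> ?q) p"
    using assms(3) by (intro int_poly_ring_hom_eqI[OF cring.axioms(1)[OF cring_H]
      ring_hom_trans[OF q assms(1)] ring_hom_trans[OF q assms(2)] _ p(1)]) (simp add: u_gen_def)
  then show ?thesis by (simp add: p(2))
qed

text \<open>The first isomorphism theorem, applied to the surjection \<open>eval_map\<close> and its
  kernel.\<close>

lemma ex_U_iso:
  obtains \<rho> where "\<rho> \<in> ring_iso (U_ring \<Phi> \<Delta>) (H_ring \<Phi> \<Delta>)"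
    "\<And>\<alpha>. \<alpha> \<in> pos \<Longrightarrow> \<rho> (u_gen \<Phi> \<Delta> \<alpha>) = h_fun \<Phi> \<Delta> \<alpha>"
proof
  interpret ring_hom_ring "int_poly_ring pos" "H_ring \<Phi> \<Delta>" eval_map by (rule eval_map_hom_ring)
  let ?\<rho> = "\<lambda>X. the_elem (eval_map ` X)"
  show "?\<rho> \<in> ring_iso (U_ring \<Phi> \<Delta>) (H_ring \<Phi> \<Delta>)"
    using FactRing_iso_set[OF eval_map_surj] by (simp add: U_ring_def eval_map_kernel)
  fix \<alpha> assume \<alpha>: "\<alpha> \<in> pos"
  have "?\<rho> (u_gen \<Phi> \<Delta> \<alpha>) = eval_map (var \<alpha>)"
    unfolding u_gen_def eval_map_kernel[symmetric]
    using the_elem_simp[OF int_poly_carrier(3)[OF \<alpha>]] .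
  then show "?\<rho> (u_gen \<Phi> \<Delta> \<alpha>) = h_fun \<Phi> \<Delta> \<alpha>" using eval_map_var[OF \<alpha>] by simp
qed

lemma image_U_filt:
  assumes "\<rho> \<in> ring_hom (U_ring \<Phi> \<Delta>) (H_ring \<Phi> \<Delta>)"
    and "\<And>\<alpha>. \<alpha> \<in> pos \<Longrightarrow> \<rho> (u_gen \<Phi> \<Delta> \<alpha>) = h_fun \<Phi> \<Delta> \<alpha>"
  shows "\<rho> ` U_filt \<Phi> \<Delta> k = H_filt \<Phi> \<Delta> k"
proof -
  have "\<rho> ` u_gen \<Phi> \<Delta> ` pos = h_fun \<Phi> \<Delta> ` pos"
    using assms(2) by (force simp: image_image)
  then show ?thesis
    unfolding U_filt_def H_filt_def
    by (simp add: filtration_image[OF cring_U cring_H assms(1) u_gen_closed])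
qed

end

theorem theorem6p3:
  fixes X :: dynkin and \<Phi> \<Delta> :: "'a::euclidean_space set"
  assumes "finite_dynkin X"
    and "root_system \<Phi>" and "irreducible_roots \<Phi>"
    and "simple_roots \<Phi> \<Delta>" and "has_dynkin_type \<Delta> X"
  shows "(\<exists>!\<rho>. \<rho> \<in> extensional (carrier (U_ring \<Phi> \<Delta>)) \<and>
            \<rho> \<in> filtered_hom (U_ring \<Phi> \<Delta>) (U_filt \<Phi> \<Delta>) (H_ring \<Phi> \<Delta>) (H_filt \<Phi> \<Delta>) \<and>
            (\<forall>\<alpha>\<in>positive_roots \<Phi> \<Delta>. \<rho> (u_gen \<Phi> \<Delta> \<alpha>) = h_fun \<Phi> \<Delta> \<alpha>)) \<and>
         (\<forall>\<rho>. \<rho> \<in> filtered_hom (U_ring \<Phi> \<Delta>) (U_filt \<Phi> \<Delta>) (H_ring \<Phi> \<Delta>) (H_filt \<Phi> \<Delta>) \<and>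
            (\<forall>\<alpha>\<in>positive_roots \<Phi> \<Delta>. \<rho> (u_gen \<Phi> \<Delta> \<alpha>) = h_fun \<Phi> \<Delta> \<alpha>) \<longrightarrow>
            \<rho> \<in> filtered_iso (U_ring \<Phi> \<Delta>) (U_filt \<Phi> \<Delta>) (H_ring \<Phi> \<Delta>) (H_filt \<Phi> \<Delta>))"
proof -
  interpret simple_root_system \<Phi> \<Delta> using assms(2,4) by unfold_locales
  interpret U: cring "U_ring \<Phi> \<Delta>" by (rule cring_U)
  obtain \<rho>0 where iso: "\<rho>0 \<in> ring_iso (U_ring \<Phi> \<Delta>) (H_ring \<Phi> \<Delta>)"
    and gen: "\<And>\<alpha>. \<alpha> \<in> pos \<Longrightarrow> \<rho>0 (u_gen \<Phi> \<Delta> \<alpha>) = h_fun \<Phi> \<Delta> \<alpha>"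
    using ex_U_iso by blast
  have hom: "\<rho>0 \<in> ring_hom (U_ring \<Phi> \<Delta>) (H_ring \<Phi> \<Delta>)"
    using iso by (simp add: ring_iso_def)
  show ?thesis
  proof (intro conjI allI impI)
    \<comment> \<open>Maps are total functions, so uniqueness can only hold after the values outside
      the carrier are fixed to \<open>undefined\<close>.\<close>
    define \<rho>1 where "\<rho>1 = restrict \<rho>0 (carrier (U_ring \<Phi> \<Delta>))"
    have hom1: "\<rho>1 \<in> ring_hom (U_ring \<Phi> \<Delta>) (H_ring \<Phi> \<Delta>)"
      by (rule U.ring_hom_restrict[OF hom]) (simp add: \<rho>1_def)
    have gen1: "\<rho>1 (u_gen \<Phi> \<Delta> \<alpha>) = h_fun \<Phi> \<Delta> \<alpha>" if "\<alpha> \<in> pos" for \<alpha>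
      using gen[OF that] u_gen_closed that by (auto simp: \<rho>1_def)
    show "\<exists>!\<rho>. \<rho> \<in> extensional (carrier (U_ring \<Phi> \<Delta>)) \<and>
            \<rho> \<in> filtered_hom (U_ring \<Phi> \<Delta>) (U_filt \<Phi> \<Delta>) (H_ring \<Phi> \<Delta>) (H_filt \<Phi> \<Delta>) \<and>
            (\<forall>\<alpha>\<in>pos. \<rho> (u_gen \<Phi> \<Delta> \<alpha>) = h_fun \<Phi> \<Delta> \<alpha>)"
    proof (rule ex1I[of _ \<rho>1], goal_cases)
      case 1
      show ?case using hom1 gen1 image_U_filt[OF hom1 gen1]
        by (auto simp: filtered_hom_def \<rho>1_def)
    next
      case (2 \<rho>)
      then have "\<rho> \<in> ring_hom (U_ring \<Phi> \<Delta>) (H_ring \<Phi> \<Delta>)" by (simp add: filtered_hom_def)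
      from U_ring_hom_eqI[OF this hom1] have "\<rho> Y = \<rho>1 Y" if "Y \<in> carrier (U_ring \<Phi> \<Delta>)" for Y
        using 2 gen1 that by simp
      moreover have "\<rho>1 \<in> extensional (carrier (U_ring \<Phi> \<Delta>))" by (simp add: \<rho>1_def)
      ultimately show ?case using 2 extensionalityI by blast
    qed
  next
    fix \<rho>
    assume \<rho>: "\<rho> \<in> filtered_hom (U_ring \<Phi> \<Delta>) (U_filt \<Phi> \<Delta>) (H_ring \<Phi> \<Delta>) (H_filt \<Phi> \<Delta>) \<and>
            (\<forall>\<alpha>\<in>pos. \<rho> (u_gen \<Phi> \<Delta> \<alpha>) = h_fun \<Phi> \<Delta> \<alpha>)"
    then have \<rho>_hom: "\<rho> \<in> ring_hom (U_ring \<Phi> \<Delta>) (H_ring \<Phi> \<Delta>)" by (simp add: filtered_hom_def)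
    \<comment> \<open>On the carrier \<open>\<rho>\<close> agrees with the isomorphism
      \<open>\<rho>0\<close>, because both have the same values on the generators.\<close>
    have "\<rho> \<in> ring_iso (U_ring \<Phi> \<Delta>) (H_ring \<Phi> \<Delta>)"
      by (rule U.ring_iso_restrict[OF iso], rule U_ring_hom_eqI[OF hom \<rho>_hom]) (use \<rho> gen in auto)
    then show "\<rho> \<in> filtered_iso (U_ring \<Phi> \<Delta>) (U_filt \<Phi> \<Delta>) (H_ring \<Phi> \<Delta>) (H_filt \<Phi> \<Delta>)"
      using image_U_filt[OF \<rho>_hom] \<rho> by (simp add: filtered_iso_def)
  qed
qed

end
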